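(* Let $\gamma\ge0$, $\sigma\in(0,1)$, $0<l_1\le l_2$. There exists a positive constant $c$, independent of $l_1$, $l_2$, $\sigma$ and $\gamma$, such that for all $(\mathbf u,w)\in V$ $$I^{(\sigma,\gamma)}[\mathbf u,w]\ge c\,l_1l_2\begin{cases}1&\text{if }\gamma\ge\sigma^{-1},\\(\sigma\gamma)^{2/3}&\text{if }\sigma^{1/2}\le\gamma\le\sigma^{-1},\\\sigma&\text{if }\gamma<\sigma^{1/2}.\end{cases}$$
   Context: Let $\Omega:=(0,l_1)\times(0,l_2)$. The admissible set is $$V:=\{(\mathbf u,w)\in H^1(\Omega;\mathbb R^2)\times H^2(\Omega): w=0,\ \mathbf u=Dw=\mathbf 0\text{ on }\{0\}\times(0,l_2),\ w\ge0\},$$ boundary values being understood in the sense of traces. For $(\mathbf u,w)\in V$ the energy is $$I^{(\sigma,\gamma)}[\mathbf u,w]=I^{(\sigma,\gamma)}[\mathbf u,w,l_1,l_2]:=\int_\Omega|D\mathbf u+(D\mathbf u)^{\mathrm T}+Dw\otimes Dw-\mathrm{Id}|^2\,dx\,dy+(\sigma l_1)^2\int_\Omega|D^2w|^2\,dx\,dy+\gamma\,|\{(x,y)\in\Omega:w(x,y)>0\}|,$$ where matrix norms are Frobenius norms, $(Dw\otimes Dw)_{ij}=\partial_iw\,\partial_jw$, $\mathrm{Id}$ is the $2\times2$ identity matrix, and $|\cdot|$ of a set is its Lebesgue measure. *)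

theory Defs
  imports "HOL-Analysis.Analysis"
begin

section \<open>Smooth functions and test functions\<close>

definition partial :: "'n \<Rightarrow> (real^'n \<Rightarrow> real) \<Rightarrow> real^'n \<Rightarrow> real" where
  "partial i f x = frechet_derivative f (at x) (axis i 1)"

primrec C_k :: "nat \<Rightarrow> (real^'n \<Rightarrow> real) \<Rightarrow> bool" where
  "C_k 0 f \<longleftrightarrow> continuous_on UNIV f"
| "C_k (Suc k) f \<longleftrightarrow> (\<forall>x. f differentiable (at x)) \<and> (\<forall>i. C_k k (partial i f))"

definition smooth :: "(real^'n \<Rightarrow> real) \<Rightarrow> bool" where
  "smooth f \<longleftrightarrow> (\<forall>k. C_k k f)"

definition test_function :: "(real^'n) set \<Rightarrow> (real^'n \<Rightarrow> real) \<Rightarrow> bool" where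
  "test_function \<Omega> \<phi> \<longleftrightarrow> smooth \<phi> \<and> compact (closure {x. \<phi> x \<noteq> 0}) \<and> closure {x. \<phi> x \<noteq> 0} \<subseteq> \<Omega>"


section \<open>Sobolev spaces\<close>

definition L2_on :: "'a::euclidean_space set \<Rightarrow> ('a \<Rightarrow> real) \<Rightarrow> bool" where
  "L2_on \<Omega> f \<longleftrightarrow> f \<in> borel_measurable (lebesgue_on \<Omega>) \<and> integrable (lebesgue_on \<Omega>) (\<lambda>x. (f x)\<^sup>2)"

definition has_weak_partial ::
    "(real^'n) set \<Rightarrow> 'n \<Rightarrow> (real^'n \<Rightarrow> real) \<Rightarrow> (real^'n \<Rightarrow> real) \<Rightarrow> bool" where
  "has_weak_partial \<Omega> i f g \<longleftrightarrow> L2_on \<Omega> f \<and> L2_on \<Omega> g \<and>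
     (\<forall>\<phi>. test_function \<Omega> \<phi> \<longrightarrow>
        (\<integral>x. f x * partial i \<phi> x \<partial>lebesgue_on \<Omega>) = - (\<integral>x. g x * \<phi> x \<partial>lebesgue_on \<Omega>))"

text \<open>Functions are used as representatives of their classes modulo null sets. On open \<open>\<Omega>\<close> a
  weak derivative is unique up to a null set, so \<open>SOME\<close> merely picks a representative; nothing
  below depends on which one is picked.\<close>

definition weak_partial ::
    "(real^'n) set \<Rightarrow> 'n \<Rightarrow> (real^'n \<Rightarrow> real) \<Rightarrow> real^'n \<Rightarrow> real" where
  "weak_partial \<Omega> i f = (SOME g. has_weak_partial \<Omega> i f g)"

definition H1 :: "(real^'n) set \<Rightarrow> (real^'n \<Rightarrow> real) set" where
  "H1 \<Omega> = {f. L2_on \<Omega> f \<and> (\<forall>i. \<exists>g. has_weak_partial \<Omega> i f g)}"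

definition H2 :: "(real^'n) set \<Rightarrow> (real^'n \<Rightarrow> real) set" where
  "H2 \<Omega> = {f \<in> H1 \<Omega>. \<forall>i. weak_partial \<Omega> i f \<in> H1 \<Omega>}"

text \<open>Squared \<open>H\<^sup>1(\<Omega>)\<close> distance between a smooth \<open>F\<close> and \<open>f \<in> H\<^sup>1(\<Omega>)\<close>; the weak derivatives of
  \<open>F\<close> are the classical ones.\<close>

definition H1_dist_sq :: "(real^'n) set \<Rightarrow> (real^'n \<Rightarrow> real) \<Rightarrow> (real^'n \<Rightarrow> real) \<Rightarrow> ennreal" where
  "H1_dist_sq \<Omega> F f =
     (\<integral>\<^sup>+x. ennreal ((F x - f x)\<^sup>2) \<partial>lebesgue_on \<Omega>)
     + (\<Sum>i\<in>UNIV. \<integral>\<^sup>+x. ennreal ((partial i F x - weak_partial \<Omega> i f x)\<^sup>2) \<partial>lebesgue_on \<Omega>)"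


section \<open>The rectangle and traces on its left edge\<close>

definition rect :: "real \<Rightarrow> real \<Rightarrow> (real^2) set" where
  "rect l1 l2 = box 0 (vector [l1, l2])"

text \<open>The trace is the continuous extension to \<open>H\<^sup>1\<close> of the restriction of functions that are
  smooth up to the boundary (equivalently, restrictions to the rectangle of smooth functions on the
  whole plane), with values in \<open>L\<^sup>2\<close> of the edge \<open>{0} \<times> (0, l2)\<close>. The graph of this
  extension is the closure of the graph of the restriction map.\<close>

definition has_left_trace :: "real \<Rightarrow> real \<Rightarrow> (real^2 \<Rightarrow> real) \<Rightarrow> (real \<Rightarrow> real) \<Rightarrow> bool" where
  "has_left_trace l1 l2 f g \<longleftrightarrow>
     f \<in> H1 (rect l1 l2) \<and> L2_on {0<..<l2} g \<and>
     (\<exists>F. (\<forall>n::nat. smooth (F n)) \<and>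
          (\<lambda>n. H1_dist_sq (rect l1 l2) (F n) f) \<longlonglongrightarrow> 0 \<and>
          (\<lambda>n. \<integral>\<^sup>+y. ennreal ((F n (vector [0, y]) - g y)\<^sup>2) \<partial>lebesgue_on {0<..<l2}) \<longlonglongrightarrow> 0)"


section \<open>The admissible set and the energy\<close>

definition V :: "real \<Rightarrow> real \<Rightarrow> ((real^2 \<Rightarrow> real^2) \<times> (real^2 \<Rightarrow> real)) set" where
  "V l1 l2 = {(u, w).
     (\<forall>i. (\<lambda>p. u p $ i) \<in> H1 (rect l1 l2)) \<and>
     w \<in> H2 (rect l1 l2) \<and>
     has_left_trace l1 l2 w (\<lambda>_. 0) \<and>
     (\<forall>i. has_left_trace l1 l2 (\<lambda>p. u p $ i) (\<lambda>_. 0)) \<and>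
     (\<forall>i. has_left_trace l1 l2 (weak_partial (rect l1 l2) i w) (\<lambda>_. 0)) \<and>
     (AE p in lebesgue_on (rect l1 l2). 0 \<le> w p)}"

definition weak_grad :: "(real^2) set \<Rightarrow> (real^2 \<Rightarrow> real) \<Rightarrow> real^2 \<Rightarrow> real^2" where
  "weak_grad \<Omega> w p = (\<chi> i. weak_partial \<Omega> i w p)"

definition weak_jacobian :: "(real^2) set \<Rightarrow> (real^2 \<Rightarrow> real^2) \<Rightarrow> real^2 \<Rightarrow> real^2^2" where
  "weak_jacobian \<Omega> u p = (\<chi> i j. weak_partial \<Omega> j (\<lambda>q. u q $ i) p)"

definition weak_hessian :: "(real^2) set \<Rightarrow> (real^2 \<Rightarrow> real) \<Rightarrow> real^2 \<Rightarrow> real^2^2" where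
  "weak_hessian \<Omega> w = weak_jacobian \<Omega> (weak_grad \<Omega> w)"

definition tensor :: "real^2 \<Rightarrow> real^2 \<Rightarrow> real^2^2" where
  "tensor a b = (\<chi> i j. a $ i * b $ j)"

text \<open>The norm of \<^typ>\<open>real^2^2\<close> is the Frobenius norm.\<close>

lemma norm_matrix_sq: "(norm (A :: real^2^2))\<^sup>2 = (\<Sum>i\<in>UNIV. \<Sum>j\<in>UNIV. (A $ i $ j)\<^sup>2)"
  by (simp add: norm_vec_def L2_set_def sum_nonneg)

text \<open>All three terms are nonnegative, so the energy is formed in \<^typ>\<open>ennreal\<close>, where a
  non-integrable integrand would give \<open>\<infinity>\<close> rather than \<open>0\<close>.\<close>

definition energy :: "real \<Rightarrow> real \<Rightarrow> real \<Rightarrow> real \<Rightarrow> (real^2 \<Rightarrow> real^2) \<Rightarrow> (real^2 \<Rightarrow> real) \<Rightarrow> ennreal" where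
  "energy \<sigma> \<gamma> l1 l2 u w = (let \<Omega> = rect l1 l2 in
     (\<integral>\<^sup>+p. ennreal ((norm (weak_jacobian \<Omega> u p + transpose (weak_jacobian \<Omega> u p)
                 + tensor (weak_grad \<Omega> w p) (weak_grad \<Omega> w p) - mat 1))\<^sup>2) \<partial>lebesgue_on \<Omega>)
     + ennreal ((\<sigma> * l1)\<^sup>2) * (\<integral>\<^sup>+p. ennreal ((norm (weak_hessian \<Omega> w p))\<^sup>2) \<partial>lebesgue_on \<Omega>)
     + ennreal \<gamma> * emeasure lebesgue {p \<in> \<Omega>. w p > 0})"

end

theory Submission
  imports Defs
begin

text \<open>
  The bound is proved along straight lines. Write \<open>e = Du + (Du)\<^sup>T + Dw \<otimes> Dw - Id\<close>. For a direction
  \<open>\<tau> = (1, t)\<close> the derivative of \<open>2 \<tau> \<cdot> u\<close> along \<open>\<tau>\<close> is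
  \<open>\<tau> \<cdot> e \<tau> - (\<partial>\<^sub>\<tau> w)\<^sup>2 + 1 + t\<^sup>2\<close>, so it involves only derivatives along the line; and \<open>u\<close> vanishes
  where the line meets the edge \<open>x = 0\<close>. Fix a point \<open>(h, y)\<close> and take the three lines with
  \<open>t = 1, -1, 0\<close> from the edge to this point. The second difference in \<open>t\<close> of \<open>\<tau> \<cdot> u(h, y)\<close> is zero
  because \<open>\<tau> \<cdot> u\<close> is affine in \<open>t\<close>, while that of \<open>(1 + t\<^sup>2) h\<close> is \<open>2 h\<close>. Hence
  the two slanted integrals of \<open>(\<partial>\<^sub>\<tau> w)\<^sup>2\<close> add up to at least \<open>2 h\<close>, up to an error controlled
  by the integrals of \<open>|e|\<close> on the three lines. For almost every \<open>y\<close> this leaves an alternative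
  (\<open>membrane_or_slope\<close>): the integral of \<open>|e|\<^sup>2\<close> is at least \<open>h / 36\<close> on one of the three lines, or
  the integral of \<open>(\<partial>\<^sub>\<tau> w)\<^sup>2\<close> is at least \<open>h / 2\<close> on one of the two slanted lines.

  In the second case let \<open>a\<close> be the length of the part of the line on which \<open>w > 0\<close>. Since \<open>w\<close> and
  \<open>Dw\<close> vanish at the edge and the slope can only change where \<open>w\<close> is nonzero, the integral of
  \<open>(\<partial>\<^sub>\<tau> w)\<^sup>2\<close> is at most \<open>a\<^sup>2\<close> times the integral of \<open>(\<partial>\<^sub>\<tau>\<^sup>2 w)\<^sup>2\<close> (\<open>slope_energy_bound\<close>). So the
  integral \<open>B\<close> of \<open>|D\<^sup>2 w|\<^sup>2\<close> on the line is at least \<open>h / (8 a\<^sup>2)\<close>. The choice \<open>h = \<sigma> l1 / 4\<close>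
  together with \<open>a \<le> h\<close> makes the bending energy on the line at least of order \<open>\<sigma> l1\<close>. The choice
  \<open>h = l1 / 4\<close> and the minimisation of \<open>\<gamma> a + (\<sigma> l1)\<^sup>2 h / (8 a\<^sup>2)\<close> over \<open>a\<close> give an energy of order
  \<open>(\<sigma> \<gamma>)\<^bsup>2/3\<^esup> l1\<close>. Both times the alternative is a membrane energy of order \<open>h\<close> on a line.

  Finally one integrates over \<open>y \<in> (h, l2 - h)\<close>: for each slope the lines fill a parallelogram inside
  the rectangle, and \<open>(y, s) \<mapsto> (s, y + t (s - h))\<close> preserves area, so the sum over the three lines
  is at most three times the energy. This gives
  \<open>energy \<ge> l1 l2 max \<sigma> (min 1 ((\<sigma> \<gamma>)\<^bsup>2/3\<^esup>)) / 864\<close> for all parameters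
  (\<open>film_energy_scaling\<close>), and the three regimes of the theorem are read off from it.

  The functions are only Sobolev functions. Their definition of traces supplies smooth
  approximations that converge in \<open>H\<^sup>1\<close> and on the edge; the fundamental theorem of calculus for these
  passes to the limit on almost every line (\<open>zero_edge_H1_AE_slant\<close>).
\<close>

section \<open>Slopes of a function of one variable and the length of its support\<close>

lemma set_nn_integral_abs_power2_le:
  fixes f :: "'a \<Rightarrow> real"
  assumes [measurable]: "f \<in> borel_measurable M" "A \<in> sets M"
  shows "(\<integral>\<^sup>+ x\<in>A. ennreal \<bar>f x\<bar> \<partial>M)\<^sup>2 \<le> emeasure M A * (\<integral>\<^sup>+ x\<in>A. ennreal ((f x)\<^sup>2) \<partial>M)"
proof -
  have "(\<integral>\<^sup>+ x\<in>A. ennreal \<bar>f x\<bar> \<partial>M)\<^sup>2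
      = (\<integral>\<^sup>+ x. indicator A x * (ennreal \<bar>f x\<bar> * indicator A x) \<partial>M)\<^sup>2"
    by (intro arg_cong[where f="\<lambda>x. x\<^sup>2"] nn_integral_cong) (auto simp: indicator_def)
  also have "\<dots> \<le> (\<integral>\<^sup>+ x. (indicator A x)\<^sup>2 \<partial>M) * (\<integral>\<^sup>+ x. (ennreal \<bar>f x\<bar> * indicator A x)\<^sup>2 \<partial>M)"
    by (rule Cauchy_Schwarz_nn_integral) measurable
  also have "(\<integral>\<^sup>+ x. (indicator A x)\<^sup>2 \<partial>M) = emeasure M A"
  proof -
    have "(\<lambda>x. (indicator A x :: ennreal)\<^sup>2) = indicator A" by (rule ext) (simp split: split_indicator)
    then show ?thesis by simp
  qed
  also have "(\<integral>\<^sup>+ x. (ennreal \<bar>f x\<bar> * indicator A x)\<^sup>2 \<partial>M) = (\<integral>\<^sup>+ x\<in>A. ennreal ((f x)\<^sup>2) \<partial>M)"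
    by (intro nn_integral_cong) (auto simp: indicator_def ennreal_power)
  finally show ?thesis .
qed

lemma set_integral_open_FTC:
  fixes F f :: "real \<Rightarrow> real"
  assumes "0 \<le> s"
    and F: "\<And>x. 0 \<le> x \<Longrightarrow> x \<le> s \<Longrightarrow> (F has_real_derivative f x) (at x within {0..s})"
    and "continuous_on {0..s} f"
  shows "(LBINT r:{0<..<s}. f r) = F s - F 0"
proof -
  have "(LBINT x=ereal 0..ereal s. f x) = F s - F 0"
    by (rule interval_integral_FTC_finite)
       (use assms in \<open>auto simp: min_def max_def has_real_derivative_iff_has_vector_derivative\<close>)
  then show ?thesis using \<open>0 \<le> s\<close>
    by (simp add: interval_lebesgue_integral_def)
qed

lemma set_integral_open_eq_integral:
  fixes k :: "real \<Rightarrow> real"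
  assumes k: "set_integrable lborel {0<..<h} k" and s: "0 \<le> s" "s \<le> h"
  shows "(LBINT r:{0<..<s}. k r) = integral {0..s} k" "k integrable_on {0..s}"
proof -
  have "set_integrable lborel {0<..<s} k"
    by (rule set_integrable_subset[OF k]) (use s in auto)
  from set_borel_integral_eq_integral[OF this]
  show "(LBINT r:{0<..<s}. k r) = integral {0..s} k" "k integrable_on {0..s}"
    by (auto simp: integrable_on_Icc_iff_Ioo integral_open_interval_real)
qed

lemma continuous_on_primitive:
  fixes k :: "real \<Rightarrow> real"
  assumes k: "set_integrable lborel {0<..<h} k" and "0 \<le> h"
  shows "continuous_on {0..h} (\<lambda>s. LBINT r:{0<..<s}. k r)"
proof -
  have "continuous_on {0..h} (\<lambda>s. integral {0..s} k)"
    using set_integral_open_eq_integral(2)[OF k, of h] \<open>0 \<le> h\<close>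
    by (intro indefinite_integral_continuous_1) auto
  then show ?thesis
    by (rule continuous_on_cong[THEN iffD1, rotated 2])
       (auto simp: set_integral_open_eq_integral[OF k])
qed

lemma primitive_has_derivative:
  fixes g :: "real \<Rightarrow> real"
  assumes g: "continuous_on {0..h} g" and s: "0 \<le> s" "s \<le> h"
  shows "((\<lambda>s. LBINT r:{0<..<s}. g r) has_real_derivative g s) (at s within {0..h})"
proof -
  have "set_integrable lborel {0..h} g"
    by (rule borel_integrable_atLeastAtMost'[OF g])
  then have k: "set_integrable lborel {0<..<h} g"
    by (rule set_integrable_subset) auto
  have "((\<lambda>u. integral {0..u} g) has_real_derivative g s) (at s within {0..h})"
    by (rule integral_has_real_derivative[OF g]) (use s in auto)
  then show ?thesis
    by (rule has_field_derivative_transform_within[OF _ zero_less_one])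
       (use s in \<open>auto simp: set_integral_open_eq_integral[OF k]\<close>)
qed

text \<open>Each point of the set is singled out by a member of a countable base.\<close>
lemma countable_if_isolated:
  fixes N :: "'a::second_countable_topology set"
  assumes "\<And>x. x \<in> N \<Longrightarrow> \<exists>T. open T \<and> x \<in> T \<and> T \<inter> N \<subseteq> {x}"
  shows "countable N"
proof -
  obtain B :: "'a set set" where B: "countable B" "topological_basis B"
    using ex_countable_basis by auto
  have "\<exists>b. b \<in> B \<and> x \<in> b \<and> b \<inter> N \<subseteq> {x}" if "x \<in> N" for x
    using assms[OF that] topological_basisE[OF B(2)] by (metis inf_mono order_refl subset_trans)
  then obtain b where b: "\<And>x. x \<in> N \<Longrightarrow> b x \<in> B \<and> x \<in> b x \<and> b x \<inter> N \<subseteq> {x}"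
    by metis
  have "inj_on b N"
    by (rule inj_onI) (use b in blast)
  moreover have "b ` N \<subseteq> B" using b by auto
  ultimately show ?thesis
    using B(1) countable_subset countable_image_inj_on by blast
qed

lemma countable_simple_zeros:
  fixes f g :: "real \<Rightarrow> real"
  assumes f: "\<And>s. a < s \<Longrightarrow> s < b \<Longrightarrow> (f has_real_derivative g s) (at s)"
  shows "countable {s \<in> {a<..<b}. f s = 0 \<and> g s \<noteq> 0}"
proof (rule countable_if_isolated)
  fix s assume s: "s \<in> {s \<in> {a<..<b}. f s = 0 \<and> g s \<noteq> 0}"
  then have d: "((\<lambda>y. (f y - f s) / (y - s)) \<longlongrightarrow> g s) (at s)"
    using f[of s] by (auto simp: has_field_derivative_iff)
  have "\<forall>\<^sub>F y in at s. (f y - f s) / (y - s) \<noteq> 0"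
    by (rule tendsto_imp_eventually_ne[OF d]) (use s in auto)
  then obtain T where "open T" "s \<in> T" "\<And>y. y \<in> T \<Longrightarrow> y \<noteq> s \<Longrightarrow> (f y - f s) / (y - s) \<noteq> 0"
    unfolding eventually_at_topological by auto
  then show "\<exists>T. open T \<and> s \<in> T \<and> T \<inter> {s \<in> {a<..<b}. f s = 0 \<and> g s \<noteq> 0} \<subseteq> {s}"
    using s by (intro exI[of _ T]) auto
qed

text \<open>Let \<open>r\<close> be the last zero of the slope \<open>g\<close> before \<open>s\<close>. Between \<open>r\<close> and \<open>s\<close> the function \<open>f\<close> is
  strictly monotone, so it has at most one zero there, and the increment \<open>g s\<close> of the slope is the
  integral of \<open>k\<close> over a set on which \<open>f\<close> is nonzero up to one point.\<close>
lemma slope_le_integral_off_zeros: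
  fixes k :: "real \<Rightarrow> real"
  assumes h: "0 \<le> h" and k: "set_integrable lborel {0<..<h} k"
  defines "g \<equiv> \<lambda>s. LBINT r:{0<..<s}. k r"
  defines "f \<equiv> \<lambda>s. LBINT r:{0<..<s}. g r"
  defines "Z \<equiv> {s \<in> {0<..<h}. f s \<noteq> 0}"
  assumes s: "0 < s" "s < h"
  shows "ennreal \<bar>g s\<bar> \<le> (\<integral>\<^sup>+ r\<in>Z. \<bar>k r\<bar> \<partial>lborel)"
proof (cases "g s = 0")
  case False
  have gc: "continuous_on {0..h} g"
    unfolding g_def by (rule continuous_on_primitive[OF k h])
  have fd: "(f has_real_derivative g x) (at x within {0..h})" if "0 \<le> x" "x \<le> h" for x
    unfolding f_def by (rule primitive_has_derivative[OF gc that])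
  define S where "S = {x \<in> {0..s}. g x = 0}"
  have g0: "g 0 = 0" unfolding g_def set_lebesgue_integral_def by simp
  have gcs: "continuous_on {0..s} g" by (rule continuous_on_subset[OF gc]) (use s in auto)
  have "closed S"
    unfolding S_def by (rule continuous_closed_preimage_constant[OF gcs]) auto
  moreover have Sne: "0 \<in> S" using g0 s unfolding S_def by auto
  moreover have bd: "bdd_above S" unfolding S_def by auto
  ultimately have "Sup S \<in> S" using closed_contains_Sup by blast
  define r where "r = Sup S"
  have r: "0 \<le> r" "r < s" "g r = 0"
    using \<open>Sup S \<in> S\<close> False unfolding r_def S_def by (auto simp: less_le)
  have nz: "g x \<noteq> 0" if "r < x" "x \<le> s" for x
  proof
    assume "g x = 0"
    then have "x \<in> S" using that r unfolding S_def by auto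
    then show False using cSup_upper[OF _ bd] that unfolding r_def by fastforce
  qed
  have one: "x = y" if xy: "r < x" "x < s" "r < y" "y < s" "f x = 0" "f y = 0" for x y
  proof (rule ccontr)
    have main: False if "r < x" "x < y" "y < s" "f x = 0" "f y = 0" for x y
    proof -
      have "\<exists>z>x. z < y \<and> g z = 0"
      proof (rule Rolle_deriv[of x y f "\<lambda>z v. g z * v", THEN exE])
        show "x < y" by fact
        show "f x = f y" using that by simp
        show "continuous_on {x..y} f"
          by (rule DERIV_continuous_on, rule DERIV_subset[OF fd]) (use that r s in auto)
        show "(f has_derivative (\<lambda>v. g z * v)) (at z)" if "x < z" "z < y" for z
          using fd[of z] that r s \<open>r < x\<close> \<open>y < s\<close>
          by (simp add: has_field_derivative_def at_within_Icc_at)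
      next
        fix z assume "x < z \<and> z < y \<and> (\<lambda>v. g z * v) = (\<lambda>v. 0)"
        then show ?thesis by (metis mult.right_neutral)
      qed
      then show False using nz that by fastforce
    qed
    assume "x \<noteq> y" then show False using main[of x y] main[of y x] xy by (cases "x < y") auto
  qed
  have "g s - g r = integral {r..s} k"
    using set_integral_open_eq_integral[OF k, of s] set_integral_open_eq_integral[OF k, of r] r s
      Henstock_Kurzweil_Integration.integral_combine[of 0 r s k] unfolding g_def by auto
  also have "\<dots> = (LBINT x:{r<..<s}. k x)"
    by (subst set_borel_integral_eq_integral(2))
       (use r s in \<open>auto simp: integral_open_interval_real intro!: set_integrable_subset[OF k]\<close>)
  finally have gs: "g s = (LBINT x:{r<..<s}. k x)" using r by simp
  have si: "set_integrable lborel {r<..<s} k"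
    by (rule set_integrable_subset[OF k]) (use r s in auto)
  have "ennreal \<bar>g s\<bar> \<le> (\<integral>\<^sup>+ x. ennreal (norm (indicator {r<..<s} x *\<^sub>R k x)) \<partial>lborel)"
    using integral_norm_bound_ennreal[OF si[unfolded set_integrable_def]] unfolding gs set_lebesgue_integral_def
    by simp
  also have "\<dots> \<le> (\<integral>\<^sup>+ x\<in>Z. \<bar>k x\<bar> \<partial>lborel)"
  proof (rule nn_integral_mono_AE)
    define E where "E = {x \<in> {r<..<s}. f x = 0}"
    have "E \<subseteq> {x}" if "x \<in> E" for x
      using one that unfolding E_def by auto
    then have "countable E" by (metis countable_empty countable_insert countable_subset ex_in_conv)
    then have "AE x in lborel. x \<notin> E"
      by (intro AE_not_in countable_imp_null_set_lborel)
    then show "AE x in lborel. ennreal (norm (indicator {r<..<s} x *\<^sub>R k x)) \<le> ennreal \<bar>k x\<bar> * indicator Z x"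
      by eventually_elim (use r s in \<open>auto simp: E_def Z_def indicator_def\<close>)
  qed
  finally show ?thesis .
qed auto

text \<open>One factor \<open>|Z|\<close> comes from the Cauchy-Schwarz inequality for the integral of \<open>|k|\<close> over \<open>Z\<close>,
  the other one from integrating the resulting pointwise bound for \<open>g\<^sup>2\<close>, which is nonzero only on
  \<open>Z\<close> up to the countable set of simple zeros of \<open>f\<close>. This quadratic dependence on the length of the
  support is what produces the exponent \<open>2/3\<close>; working with the area of the support in the plane
  would give only a linear one.\<close>
lemma slope_energy_bound:
  fixes k :: "real \<Rightarrow> real"
  assumes h: "0 \<le> h" and k: "set_integrable lborel {0<..<h} k" and [measurable]: "k \<in> borel_measurable borel"
  defines "g \<equiv> \<lambda>s. LBINT r:{0<..<s}. k r"
  defines "f \<equiv> \<lambda>s. LBINT r:{0<..<s}. g r"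
  defines "Z \<equiv> {s \<in> {0<..<h}. f s \<noteq> 0}"
  shows "(\<integral>\<^sup>+ s\<in>{0<..<h}. (g s)\<^sup>2 \<partial>lborel) \<le> (emeasure lborel Z)\<^sup>2 * (\<integral>\<^sup>+ s\<in>{0<..<h}. (k s)\<^sup>2 \<partial>lborel)"
proof -
  have gc: "continuous_on {0..h} g"
    unfolding g_def by (rule continuous_on_primitive[OF k h])
  have fd: "(f has_real_derivative g x) (at x within {0..h})" if "0 \<le> x" "x \<le> h" for x
    unfolding f_def by (rule primitive_has_derivative[OF gc that])
  have fd': "(f has_real_derivative g x) (at x)" if "0 < x" "x < h" for x
    using fd[of x] that by (simp add: at_within_Icc_at)
  have "continuous_on {0<..<h} f"
    by (rule DERIV_continuous_on, rule DERIV_subset[OF fd]) auto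
  then have "open Z"
    unfolding Z_def using continuous_open_preimage[of "{0<..<h}" f "-{0}"]
    by (auto simp: vimage_def Int_def)
  then have Zm[measurable]: "Z \<in> sets borel" by auto
  let ?b = "\<integral>\<^sup>+ s\<in>{0<..<h}. (k s)\<^sup>2 \<partial>lborel"
  have cs: "(\<integral>\<^sup>+ r\<in>Z. \<bar>k r\<bar> \<partial>lborel)\<^sup>2 \<le> emeasure lborel Z * ?b"
  proof -
    have "(\<integral>\<^sup>+ r\<in>Z. \<bar>k r\<bar> \<partial>lborel)\<^sup>2 \<le> emeasure lborel Z * (\<integral>\<^sup>+ r\<in>Z. ennreal ((k r)\<^sup>2) \<partial>lborel)"
      by (rule set_nn_integral_abs_power2_le) auto
    also have "\<dots> \<le> emeasure lborel Z * ?b"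
      by (intro mult_left_mono nn_integral_mono) (auto simp: indicator_def Z_def)
    finally show ?thesis .
  qed
  have "(\<integral>\<^sup>+ s\<in>{0<..<h}. (g s)\<^sup>2 \<partial>lborel) \<le> (\<integral>\<^sup>+ s. (emeasure lborel Z * ?b) * indicator Z s \<partial>lborel)"
  proof (rule nn_integral_mono_AE)
    have "AE x in lborel. x \<notin> {s \<in> {0<..<h}. f s = 0 \<and> g s \<noteq> 0}"
      by (intro AE_not_in countable_imp_null_set_lborel countable_simple_zeros fd')
    then show "AE s in lborel. ennreal ((g s)\<^sup>2) * indicator {0<..<h} s \<le> (emeasure lborel Z * ?b) * indicator Z s"
    proof eventually_elim
      case (elim s)
      show ?case
      proof (cases "s \<in> {0<..<h} \<and> g s \<noteq> 0")
        case True
        with elim have s: "s \<in> Z" "0 < s" "s < h" by (auto simp: Z_def)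
        have "ennreal \<bar>g s\<bar> \<le> (\<integral>\<^sup>+ r\<in>Z. \<bar>k r\<bar> \<partial>lborel)"
          unfolding Z_def f_def g_def by (rule slope_le_integral_off_zeros[OF h k s(2,3)])
        then have "(ennreal \<bar>g s\<bar>)\<^sup>2 \<le> (\<integral>\<^sup>+ r\<in>Z. \<bar>k r\<bar> \<partial>lborel)\<^sup>2"
          by (rule power_mono) simp
        also note cs
        finally show ?thesis using s by (simp add: ennreal_power)
      qed auto
    qed
  qed
  also have "\<dots> = (emeasure lborel Z)\<^sup>2 * ?b"
    by (subst nn_integral_cmult_indicator) (simp_all add: power2_eq_square mult_ac)
  finally show ?thesis .
qed

section \<open>Slanted lines ending at a common point\<close>

text \<open>All lines, whatever their slope, are parametrised by the height \<open>y\<close> at which they reach the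
  abscissa \<open>h\<close>. Integrals over lines of different slopes are thus compared at a common end point.\<close>
definition slant :: "real \<Rightarrow> real \<Rightarrow> real \<Rightarrow> real \<Rightarrow> real \<times> real" where
  "slant t h y s = (s, y + t * (s - h))"

lemma slant_measurable [measurable]:
  assumes [measurable]: "f \<in> borel_measurable M" "g \<in> borel_measurable M"
  shows "(\<lambda>x. slant t h (f x) (g x)) \<in> borel_measurable M"
  unfolding slant_def by measurable

lemma slant_in_rectangle:
  assumes "y \<in> {h<..<l2 - h}" "s \<in> {0<..<h}" "h \<le> l1" "\<bar>t\<bar> \<le> 1"
  shows "slant t h y s \<in> {0<..<l1} \<times> {0<..<l2}"
proof -
  have "\<bar>t * (s - h)\<bar> \<le> 1 * h"
    unfolding abs_mult using assms by (intro mult_mono) auto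
  then show ?thesis using assms by (auto simp: slant_def abs_le_iff)
qed

text \<open>For fixed \<open>s\<close> the map \<open>y \<mapsto> y + t (s - h)\<close> is a translation.\<close>
lemma nn_integral_slant:
  fixes f :: "real \<times> real \<Rightarrow> ennreal"
  assumes [measurable]: "f \<in> borel_measurable borel"
  shows "(\<integral>\<^sup>+ y. \<integral>\<^sup>+ s. f (slant t h y s) \<partial>lborel \<partial>lborel) = (\<integral>\<^sup>+ p. f p \<partial>lborel)"
proof -
  have "(\<integral>\<^sup>+ y. \<integral>\<^sup>+ s. f (slant t h y s) \<partial>lborel \<partial>lborel)
      = (\<integral>\<^sup>+ s. \<integral>\<^sup>+ y. f (slant t h y s) \<partial>lborel \<partial>lborel)"
    by (rule lborel_pair.Fubini') measurable
  also have "\<dots> = (\<integral>\<^sup>+ s. \<integral>\<^sup>+ y. f (s, y) \<partial>lborel \<partial>lborel)"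
  proof (rule nn_integral_cong)
    fix s
    have "(\<integral>\<^sup>+ y. f (s, y) \<partial>lborel) = ennreal \<bar>1\<bar> * (\<integral>\<^sup>+ y. f (s, t * (s - h) + 1 * y) \<partial>lborel)"
      by (rule nn_integral_real_affine) auto
    then show "(\<integral>\<^sup>+ y. f (slant t h y s) \<partial>lborel) = (\<integral>\<^sup>+ y. f (s, y) \<partial>lborel)"
      by (simp add: slant_def add.commute)
  qed
  also have "\<dots> = (\<integral>\<^sup>+ p. f p \<partial>(lborel \<Otimes>\<^sub>M lborel))"
    by (rule lborel.nn_integral_fst) (simp add: lborel_prod)
  finally show ?thesis by (simp add: lborel_prod)
qed

lemma nn_integral_slant_le:
  fixes f :: "real \<times> real \<Rightarrow> ennreal"
  assumes [measurable]: "f \<in> borel_measurable borel" and "h \<le> l1" "\<bar>t\<bar> \<le> 1"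
  shows "(\<integral>\<^sup>+ y\<in>{h<..<l2 - h}. (\<integral>\<^sup>+ s\<in>{0<..<h}. f (slant t h y s) \<partial>lborel) \<partial>lborel)
    \<le> (\<integral>\<^sup>+ p\<in>{0<..<l1} \<times> {0<..<l2}. f p \<partial>lborel)"
proof -
  have [measurable]: "{0<..<l1} \<times> {0<..<l2} \<in> sets borel"
    by (intro borel_open open_Times) auto
  have "(\<integral>\<^sup>+ y\<in>{h<..<l2 - h}. (\<integral>\<^sup>+ s\<in>{0<..<h}. f (slant t h y s) \<partial>lborel) \<partial>lborel)
     \<le> (\<integral>\<^sup>+ y. \<integral>\<^sup>+ s. f (slant t h y s) * indicator ({0<..<l1} \<times> {0<..<l2}) (slant t h y s) \<partial>lborel \<partial>lborel)"
  proof (rule nn_integral_mono)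
    fix y
    show "(\<integral>\<^sup>+ s\<in>{0<..<h}. f (slant t h y s) \<partial>lborel) * indicator {h<..<l2 - h} y
      \<le> (\<integral>\<^sup>+ s. f (slant t h y s) * indicator ({0<..<l1} \<times> {0<..<l2}) (slant t h y s) \<partial>lborel)"
    proof (cases "y \<in> {h<..<l2 - h}")
      case True
      have "f (slant t h y s) * indicator {0<..<h} s
          \<le> f (slant t h y s) * indicator ({0<..<l1} \<times> {0<..<l2}) (slant t h y s)" for s
        using slant_in_rectangle[OF True _ assms(2,3), of s] by (cases "s \<in> {0<..<h}") simp_all
      then show ?thesis using True by (auto intro!: nn_integral_mono)
    qed auto
  qed
  also have "\<dots> = (\<integral>\<^sup>+ p\<in>{0<..<l1} \<times> {0<..<l2}. f p \<partial>lborel)"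
    by (rule nn_integral_slant) measurable
  finally show ?thesis .
qed

text \<open>A null set of the plane meets almost every line of a given slope in a null set of the line.\<close>
lemma AE_slant:
  assumes ae: "AE p in lborel. p \<in> {0<..<l1} \<times> {0<..<l2} \<longrightarrow> P p"
    and "h \<le> l1" "\<bar>t\<bar> \<le> 1"
  shows "AE y in lborel. y \<in> {h<..<l2 - h} \<longrightarrow> (AE s in lborel. s \<in> {0<..<h} \<longrightarrow> P (slant t h y s))"
proof -
  obtain N where N: "{p \<in> space lborel. \<not> (p \<in> {0<..<l1} \<times> {0<..<l2} \<longrightarrow> P p)} \<subseteq> N"
    "emeasure lborel N = 0" "N \<in> sets lborel"
    using ae by (rule AE_E)
  then have [measurable]: "N \<in> sets borel" by simp
  have "(\<integral>\<^sup>+ y. \<integral>\<^sup>+ s. indicator N (slant t h y s) \<partial>lborel \<partial>lborel) = 0"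
    using N(2) by (subst nn_integral_slant) auto
  then have "AE y in lborel. (\<integral>\<^sup>+ s. indicator N (slant t h y s) \<partial>lborel) = 0"
    by (subst (asm) nn_integral_0_iff_AE) auto
  then show ?thesis
  proof eventually_elim
    case (elim y)
    then have "AE s in lborel. indicator N (slant t h y s) = (0::ennreal)"
      by (subst (asm) nn_integral_0_iff_AE) auto
    then have "AE s in lborel. slant t h y s \<notin> N"
      by eventually_elim (auto simp: indicator_def split: if_splits)
    then have "AE s in lborel. s \<in> {0<..<h} \<longrightarrow> P (slant t h y s)" if "y \<in> {h<..<l2 - h}"
      by eventually_elim (use N(1) slant_in_rectangle[OF that _ assms(2,3)] in auto)
    then show ?case by blast
  qed
qed

lemma square_integrable_on_interval:
  fixes \<phi> :: "real \<Rightarrow> real"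
  assumes [measurable]: "\<phi> \<in> borel_measurable borel"
    and fin: "(\<integral>\<^sup>+ s\<in>{0<..<h}. ennreal ((\<phi> s)\<^sup>2) \<partial>lborel) < \<infinity>"
  shows "set_integrable lborel {0<..<h} (\<lambda>s. (\<phi> s)\<^sup>2)" "set_integrable lborel {0<..<h} \<phi>"
proof -
  have eq: "(\<integral>\<^sup>+ s. norm (indicator {0<..<h} s *\<^sub>R (\<phi> s)\<^sup>2) \<partial>lborel) = (\<integral>\<^sup>+ s\<in>{0<..<h}. ennreal ((\<phi> s)\<^sup>2) \<partial>lborel)"
    by (intro nn_integral_cong) (auto simp: indicator_def)
  show sq: "set_integrable lborel {0<..<h} (\<lambda>s. (\<phi> s)\<^sup>2)"
    unfolding set_integrable_def by (rule integrableI_bounded) (use fin in \<open>auto simp only: eq, measurable\<close>)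
  have one: "set_integrable lborel {0<..<h} (\<lambda>s. 1::real)"
    unfolding set_integrable_def by (cases "0 \<le> h") (simp_all add: integrable_indicator_iff)
  have bound: "norm (indicat_real {0<..<h} x *\<^sub>R \<phi> x) \<le> norm (indicat_real {0<..<h} x *\<^sub>R (1 + (\<phi> x)\<^sup>2))" for x
  proof -
    have "0 \<le> (\<bar>\<phi> x\<bar> - 1)\<^sup>2" by simp
    then have "2 * \<bar>\<phi> x\<bar> \<le> 1 + (\<phi> x)\<^sup>2" by (simp add: power2_diff)
    moreover have "0 \<le> (\<phi> x)\<^sup>2" by simp
    ultimately show ?thesis by (auto simp: indicator_def)
  qed
  show "set_integrable lborel {0<..<h} \<phi>"
    unfolding set_integrable_def
    by (rule Bochner_Integration.integrable_bound[OF set_integral_add(1)[OF one sq, unfolded set_integrable_def]])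
       (use bound in \<open>auto, measurable\<close>)
qed

lemma AE_slant_square_integrable:
  fixes d :: "real \<times> real \<Rightarrow> real"
  assumes [measurable]: "d \<in> borel_measurable borel"
    and fin: "(\<integral>\<^sup>+ p\<in>{0<..<l1} \<times> {0<..<l2}. ennreal ((d p)\<^sup>2) \<partial>lborel) < \<infinity>"
    and ht: "h \<le> l1" "\<bar>t\<bar> \<le> 1"
  shows "AE y in lborel. y \<in> {h<..<l2 - h} \<longrightarrow> (\<integral>\<^sup>+ s\<in>{0<..<h}. ennreal ((d (slant t h y s))\<^sup>2) \<partial>lborel) < \<infinity>"
proof -
  have "(\<integral>\<^sup>+ y\<in>{h<..<l2 - h}. (\<integral>\<^sup>+ s\<in>{0<..<h}. ennreal ((d (slant t h y s))\<^sup>2) \<partial>lborel) \<partial>lborel) \<noteq> \<infinity>"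
    using nn_integral_slant_le[of "\<lambda>p. ennreal ((d p)\<^sup>2)" h l1 t l2] ht fin by (auto simp: top_unique)
  then have "AE y in lborel. (\<integral>\<^sup>+ s\<in>{0<..<h}. ennreal ((d (slant t h y s))\<^sup>2) \<partial>lborel) * indicator {h<..<l2 - h} y \<noteq> \<infinity>"
    by (rule nn_integral_PInf_AE[rotated]) measurable
  then show ?thesis
    by eventually_elim (auto simp: less_top)
qed

section \<open>Functions that vanish on the left edge\<close>

text \<open>What the argument retains of the statement that \<open>f\<close> is in \<open>H\<^sup>1\<close> of the rectangle, has the
  derivatives \<open>d1\<close> and \<open>d2\<close>, and has trace zero on the left edge. Convergence of the approximations
  is required in \<open>L\<^sup>1\<close> only, because this norm passes to almost all lines by Fubini's theorem;
  square integrability of \<open>d1\<close> and \<open>d2\<close> is kept for the products on the lines. The functions are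
  Borel, rather than Lebesgue, measurable so that they can be composed with \<open>slant\<close>.\<close>
definition zero_edge_H1 ::
    "real \<Rightarrow> real \<Rightarrow> (real \<times> real \<Rightarrow> real) \<Rightarrow> (real \<times> real \<Rightarrow> real) \<Rightarrow> (real \<times> real \<Rightarrow> real) \<Rightarrow> bool" where
  "zero_edge_H1 l1 l2 f d1 d2 \<longleftrightarrow>
     f \<in> borel_measurable borel \<and> d1 \<in> borel_measurable borel \<and> d2 \<in> borel_measurable borel \<and>
     (\<integral>\<^sup>+ p\<in>{0<..<l1} \<times> {0<..<l2}. ennreal ((d1 p)\<^sup>2) \<partial>lborel) < \<infinity> \<and>
     (\<integral>\<^sup>+ p\<in>{0<..<l1} \<times> {0<..<l2}. ennreal ((d2 p)\<^sup>2) \<partial>lborel) < \<infinity> \<and>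
     (\<exists>F D1 D2. (\<forall>n::nat. continuous_on UNIV (D1 n) \<and> continuous_on UNIV (D2 n) \<and>
          (\<forall>p. (F n has_derivative (\<lambda>v. fst v * D1 n p + snd v * D2 n p)) (at p))) \<and>
        (\<lambda>n. \<integral>\<^sup>+ p\<in>{0<..<l1} \<times> {0<..<l2}. ennreal \<bar>F n p - f p\<bar> \<partial>lborel) \<longlonglongrightarrow> 0 \<and>
        (\<lambda>n. \<integral>\<^sup>+ p\<in>{0<..<l1} \<times> {0<..<l2}. ennreal \<bar>D1 n p - d1 p\<bar> \<partial>lborel) \<longlonglongrightarrow> 0 \<and>
        (\<lambda>n. \<integral>\<^sup>+ p\<in>{0<..<l1} \<times> {0<..<l2}. ennreal \<bar>D2 n p - d2 p\<bar> \<partial>lborel) \<longlonglongrightarrow> 0 \<and>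
        (\<lambda>n. \<integral>\<^sup>+ y\<in>{0<..<l2}. ennreal \<bar>F n (0, y)\<bar> \<partial>lborel) \<longlonglongrightarrow> 0)"

lemma zero_edge_H1_square_integrable:
  assumes "zero_edge_H1 l1 l2 f d1 d2"
  shows "(\<integral>\<^sup>+ p\<in>{0<..<l1} \<times> {0<..<l2}. ennreal ((d1 p)\<^sup>2) \<partial>lborel) < \<infinity>"
    "(\<integral>\<^sup>+ p\<in>{0<..<l1} \<times> {0<..<l2}. ennreal ((d2 p)\<^sup>2) \<partial>lborel) < \<infinity>"
  using assms unfolding zero_edge_H1_def by auto

text \<open>The increment along the line, from the left edge to the abscissa \<open>s\<close>, of a function with partial
  derivatives \<open>d1\<close> and \<open>d2\<close>.\<close>
definition slant_int ::
  "real \<Rightarrow> real \<Rightarrow> (real \<times> real \<Rightarrow> real) \<Rightarrow> (real \<times> real \<Rightarrow> real) \<Rightarrow> real \<Rightarrow> real \<Rightarrow> real" where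
  "slant_int t h d1 d2 y s = (LBINT r:{0<..<s}. d1 (slant t h y r) + t * d2 (slant t h y r))"

lemma slant_int_measurable [measurable]:
  assumes [measurable]: "d1 \<in> borel_measurable borel" "d2 \<in> borel_measurable borel"
    "f \<in> borel_measurable M" "g \<in> borel_measurable M"
  shows "(\<lambda>x. slant_int t h d1 d2 (f x) (g x)) \<in> borel_measurable M"
proof -
  have "(\<lambda>x. slant_int t h d1 d2 (f x) (g x)) = (\<lambda>x. \<integral>r. (if 0 < r \<and> r < g x then 1 else 0) *
      (d1 (slant t h (f x) r) + t * d2 (slant t h (f x) r)) \<partial>lborel)"
    unfolding slant_int_def set_lebesgue_integral_def
    by (intro ext Bochner_Integration.integral_cong) auto
  then show ?thesis by simp
qed

lemma slant_FTC:
  fixes F D1 D2 :: "real \<times> real \<Rightarrow> real"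
  assumes D: "continuous_on UNIV D1" "continuous_on UNIV D2"
    and F: "\<And>p. (F has_derivative (\<lambda>v. fst v * D1 p + snd v * D2 p)) (at p)"
    and s: "0 \<le> s"
  shows "slant_int t h D1 D2 y s = F (slant t h y s) - F (0, y - t * h)"
proof -
  have c: "continuous_on S (\<lambda>r. slant t h y r)" for S
    unfolding slant_def by (intro continuous_intros)
  have "(LBINT r:{0<..<s}. D1 (slant t h y r) + t * D2 (slant t h y r)) = F (slant t h y s) - F (slant t h y 0)"
  proof (rule set_integral_open_FTC[OF s])
    show "continuous_on {0..s} (\<lambda>r. D1 (slant t h y r) + t * D2 (slant t h y r))"
      by (intro continuous_intros continuous_on_compose2[OF D(1) c] continuous_on_compose2[OF D(2) c]) auto
    fix x
    have "((\<lambda>r. slant t h y r) has_derivative (\<lambda>v. (v, v * t))) (at x within {0..s})"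
      unfolding slant_def by (auto intro!: derivative_eq_intros)
    from has_derivative_compose[OF this F]
    show "((\<lambda>r. F (slant t h y r)) has_real_derivative D1 (slant t h y x) + t * D2 (slant t h y x)) (at x within {0..s})"
      unfolding has_field_derivative_def
      by (rule has_derivative_eq_rhs) (auto simp: algebra_simps)
  qed
  then show ?thesis by (simp add: slant_int_def slant_def)
qed

text \<open>A smooth function is its value on the edge plus its increment, so the discrepancy is at most the
  value on the edge plus the error of the derivatives on the line; integrated over \<open>y\<close> these are
  integrals over the edge and over the rectangle.\<close>
lemma slant_int_error:
  fixes F D1 D2 :: "real \<times> real \<Rightarrow> real"
  assumes D: "continuous_on UNIV D1" "continuous_on UNIV D2"
    and F: "\<And>p. (F has_derivative (\<lambda>v. fst v * D1 p + snd v * D2 p)) (at p)"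
    and d[measurable]: "d1 \<in> borel_measurable borel" "d2 \<in> borel_measurable borel"
    and fin: "(\<integral>\<^sup>+ p\<in>{0<..<l1} \<times> {0<..<l2}. ennreal ((d1 p)\<^sup>2) \<partial>lborel) < \<infinity>"
      "(\<integral>\<^sup>+ p\<in>{0<..<l1} \<times> {0<..<l2}. ennreal ((d2 p)\<^sup>2) \<partial>lborel) < \<infinity>"
    and s: "0 \<le> s" "s \<le> h" and h: "h \<le> l1" and t: "\<bar>t\<bar> \<le> 1"
  shows "(\<integral>\<^sup>+ y\<in>{h<..<l2 - h}. ennreal \<bar>F (slant t h y s) - slant_int t h d1 d2 y s\<bar> \<partial>lborel)
    \<le> (\<integral>\<^sup>+ y\<in>{0<..<l2}. ennreal \<bar>F (0, y)\<bar> \<partial>lborel)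
      + (\<integral>\<^sup>+ p\<in>{0<..<l1} \<times> {0<..<l2}. ennreal \<bar>D1 p - d1 p\<bar> \<partial>lborel)
      + (\<integral>\<^sup>+ p\<in>{0<..<l1} \<times> {0<..<l2}. ennreal \<bar>D2 p - d2 p\<bar> \<partial>lborel)"
proof -
  have [measurable]: "D1 \<in> borel_measurable borel" "D2 \<in> borel_measurable borel"
    using D borel_measurable_continuous_onI by auto
  have "continuous_on UNIV F"
    by (rule has_derivative_continuous_on, rule F)
  then have [measurable]: "F \<in> borel_measurable borel" by (rule borel_measurable_continuous_onI)
  let ?R = "\<lambda>y. \<integral>\<^sup>+ r\<in>{0<..<h}. (ennreal \<bar>D1 (slant t h y r) - d1 (slant t h y r)\<bar>
      + ennreal \<bar>D2 (slant t h y r) - d2 (slant t h y r)\<bar>) \<partial>lborel"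
  have "(\<integral>\<^sup>+ y\<in>{h<..<l2 - h}. ennreal \<bar>F (slant t h y s) - slant_int t h d1 d2 y s\<bar> \<partial>lborel)
    \<le> (\<integral>\<^sup>+ y. ennreal \<bar>F (0, y - t * h)\<bar> * indicator {h<..<l2 - h} y + ?R y * indicator {h<..<l2 - h} y \<partial>lborel)"
  proof (rule nn_integral_mono_AE)
    show "AE y in lborel. ennreal \<bar>F (slant t h y s) - slant_int t h d1 d2 y s\<bar> * indicator {h<..<l2 - h} y
      \<le> ennreal \<bar>F (0, y - t * h)\<bar> * indicator {h<..<l2 - h} y + ?R y * indicator {h<..<l2 - h} y"
      using AE_slant_square_integrable[OF d(1) fin(1) h t] AE_slant_square_integrable[OF d(2) fin(2) h t]
    proof eventually_elim
      case (elim y)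
      show ?case
      proof (cases "y \<in> {h<..<l2 - h}")
        case True
        have i: "set_integrable lborel {0<..<s} (\<lambda>r. d1 (slant t h y r))"
          "set_integrable lborel {0<..<s} (\<lambda>r. d2 (slant t h y r))"
          using elim True s
          by (auto intro!: set_integrable_subset[OF square_integrable_on_interval(2)])
        have c: "continuous_on S (\<lambda>r. slant t h y r)" for S
          unfolding slant_def by (intro continuous_intros)
        have iD: "set_integrable lborel {0<..<s} (\<lambda>r. D1 (slant t h y r))"
          "set_integrable lborel {0<..<s} (\<lambda>r. D2 (slant t h y r))"
          by (rule set_integrable_subset[OF borel_integrable_atLeastAtMost'[of 0 s]],
              auto intro!: continuous_on_compose2[OF D(1) c] continuous_on_compose2[OF D(2) c])+
        let ?e = "\<lambda>r. (D1 (slant t h y r) - d1 (slant t h y r)) + t * (D2 (slant t h y r) - d2 (slant t h y r))"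
        have ie: "set_integrable lborel {0<..<s} ?e"
          by (intro set_integral_add set_integral_diff set_integrable_mult_right i iD)
        have "slant_int t h D1 D2 y s - slant_int t h d1 d2 y s = (LBINT r:{0<..<s}. ?e r)"
          unfolding slant_int_def
          by (subst set_integral_diff(2)[symmetric])
             (auto intro!: set_integral_add set_integrable_mult_right i iD simp: algebra_simps)
        then have "F (slant t h y s) - slant_int t h d1 d2 y s = F (0, y - t * h) + (LBINT r:{0<..<s}. ?e r)"
          using slant_FTC[OF D F s(1), of t h y] by simp
        then have "ennreal \<bar>F (slant t h y s) - slant_int t h d1 d2 y s\<bar>
            \<le> ennreal (\<bar>F (0, y - t * h)\<bar> + \<bar>LBINT r:{0<..<s}. ?e r\<bar>)"
          by (intro ennreal_leI) linarith
        also have "\<dots> = ennreal \<bar>F (0, y - t * h)\<bar> + ennreal \<bar>LBINT r:{0<..<s}. ?e r\<bar>"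
          by simp
        also have "ennreal \<bar>LBINT r:{0<..<s}. ?e r\<bar> \<le> (\<integral>\<^sup>+ r. ennreal (norm (indicator {0<..<s} r *\<^sub>R ?e r)) \<partial>lborel)"
          using integral_norm_bound_ennreal[OF ie[unfolded set_integrable_def]]
          unfolding set_lebesgue_integral_def by simp
        also have "\<dots> \<le> ?R y"
        proof (rule nn_integral_mono)
          fix r
          let ?a = "D1 (slant t h y r) - d1 (slant t h y r)" and ?b = "D2 (slant t h y r) - d2 (slant t h y r)"
          have "\<bar>?a + t * ?b\<bar> \<le> \<bar>?a\<bar> + \<bar>t\<bar> * \<bar>?b\<bar>"
            using abs_triangle_ineq[of ?a "t * ?b"] by (simp add: abs_mult)
          also have "\<dots> \<le> \<bar>?a\<bar> + \<bar>?b\<bar>"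
            using mult_right_mono[OF t, of "\<bar>?b\<bar>"] by simp
          finally have "ennreal \<bar>?a + t * ?b\<bar> \<le> ennreal \<bar>?a\<bar> + ennreal \<bar>?b\<bar>"
            by (simp add: ennreal_leI flip: ennreal_plus)
          then show "ennreal (norm (indicator {0<..<s} r *\<^sub>R ?e r))
             \<le> (ennreal \<bar>?a\<bar> + ennreal \<bar>?b\<bar>) * indicator {0<..<h} r"
            using s by (auto simp: indicator_def)
        qed
        finally show ?thesis using True by (simp add: add_left_mono)
      qed auto
    qed
  qed
  also have "\<dots> = (\<integral>\<^sup>+ y. ennreal \<bar>F (0, y - t * h)\<bar> * indicator {h<..<l2 - h} y \<partial>lborel)
      + (\<integral>\<^sup>+ y\<in>{h<..<l2 - h}. ?R y \<partial>lborel)"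
    by (rule nn_integral_add) measurable
  also have "(\<integral>\<^sup>+ y\<in>{h<..<l2 - h}. ?R y \<partial>lborel)
      \<le> (\<integral>\<^sup>+ p\<in>{0<..<l1} \<times> {0<..<l2}. (ennreal \<bar>D1 p - d1 p\<bar> + ennreal \<bar>D2 p - d2 p\<bar>) \<partial>lborel)"
    by (rule nn_integral_slant_le[OF _ h t]) measurable
  also have "\<dots> = (\<integral>\<^sup>+ p\<in>{0<..<l1} \<times> {0<..<l2}. ennreal \<bar>D1 p - d1 p\<bar> \<partial>lborel)
      + (\<integral>\<^sup>+ p\<in>{0<..<l1} \<times> {0<..<l2}. ennreal \<bar>D2 p - d2 p\<bar> \<partial>lborel)"
  proof -
    have [measurable]: "{0<..<l1} \<times> {0<..<l2} \<in> sets borel"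
      by (intro borel_open open_Times) auto
    show ?thesis by (subst nn_integral_add[symmetric]) (auto simp: distrib_right)
  qed
  also have "(\<integral>\<^sup>+ y. ennreal \<bar>F (0, y - t * h)\<bar> * indicator {h<..<l2 - h} y \<partial>lborel)
      \<le> (\<integral>\<^sup>+ y. ennreal \<bar>F (0, y - t * h)\<bar> * indicator {0<..<l2} (y - t * h) \<partial>lborel)"
  proof (rule nn_integral_mono)
    fix y
    have "\<bar>t * h\<bar> \<le> 1 * h"
      unfolding abs_mult using s t by (intro mult_mono) auto
    then show "ennreal \<bar>F (0, y - t * h)\<bar> * indicator {h<..<l2 - h} y
      \<le> ennreal \<bar>F (0, y - t * h)\<bar> * indicator {0<..<l2} (y - t * h)"
      by (auto simp: indicator_def abs_le_iff)
  qed
  also have "\<dots> = (\<integral>\<^sup>+ y\<in>{0<..<l2}. ennreal \<bar>F (0, y)\<bar> \<partial>lborel)"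
    by (subst (2) nn_integral_real_affine[where c=1 and t="- (t * h)"]) auto
  finally show ?thesis by (simp add: add.assoc)
qed

text \<open>One error bound serves all slopes and all abscissas, including the end point \<open>s = h\<close>, at which
  \<open>slant t h y s\<close> is the same point for every \<open>t\<close>.\<close>
lemma zero_edge_H1_approx:
  assumes f: "zero_edge_H1 l1 l2 f d1 d2" and h: "h \<le> l1"
  obtains F :: "nat \<Rightarrow> real \<times> real \<Rightarrow> real" and \<delta> :: "nat \<Rightarrow> ennreal" where
    "\<And>n. F n \<in> borel_measurable borel" "\<delta> \<longlonglongrightarrow> 0"
    "(\<lambda>n. \<integral>\<^sup>+ p\<in>{0<..<l1} \<times> {0<..<l2}. ennreal \<bar>F n p - f p\<bar> \<partial>lborel) \<longlonglongrightarrow> 0"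
    "\<And>n t s. \<bar>t\<bar> \<le> 1 \<Longrightarrow> 0 \<le> s \<Longrightarrow> s \<le> h \<Longrightarrow>
      (\<integral>\<^sup>+ y\<in>{h<..<l2 - h}. ennreal \<bar>F n (slant t h y s) - slant_int t h d1 d2 y s\<bar> \<partial>lborel) \<le> \<delta> n"
proof -
  obtain F D1 D2 where D: "\<And>n::nat. continuous_on UNIV (D1 n)" "\<And>n. continuous_on UNIV (D2 n)"
    and F: "\<And>n p. (F n has_derivative (\<lambda>v. fst v * D1 n p + snd v * D2 n p)) (at p)"
    and lim: "(\<lambda>n. \<integral>\<^sup>+ p\<in>{0<..<l1} \<times> {0<..<l2}. ennreal \<bar>F n p - f p\<bar> \<partial>lborel) \<longlonglongrightarrow> 0"
        "(\<lambda>n. \<integral>\<^sup>+ p\<in>{0<..<l1} \<times> {0<..<l2}. ennreal \<bar>D1 n p - d1 p\<bar> \<partial>lborel) \<longlonglongrightarrow> 0"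
        "(\<lambda>n. \<integral>\<^sup>+ p\<in>{0<..<l1} \<times> {0<..<l2}. ennreal \<bar>D2 n p - d2 p\<bar> \<partial>lborel) \<longlonglongrightarrow> 0"
        "(\<lambda>n. \<integral>\<^sup>+ y\<in>{0<..<l2}. ennreal \<bar>F n (0, y)\<bar> \<partial>lborel) \<longlonglongrightarrow> 0"
    using f unfolding zero_edge_H1_def by blast
  have d: "d1 \<in> borel_measurable borel" "d2 \<in> borel_measurable borel"
    and fin: "(\<integral>\<^sup>+ p\<in>{0<..<l1} \<times> {0<..<l2}. ennreal ((d1 p)\<^sup>2) \<partial>lborel) < \<infinity>"
      "(\<integral>\<^sup>+ p\<in>{0<..<l1} \<times> {0<..<l2}. ennreal ((d2 p)\<^sup>2) \<partial>lborel) < \<infinity>"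
    using f unfolding zero_edge_H1_def by auto
  show thesis
  proof (rule that)
    show "F n \<in> borel_measurable borel" for n
      by (rule borel_measurable_continuous_onI, rule has_derivative_continuous_on, rule F)
    have "(\<lambda>n. (\<integral>\<^sup>+ y\<in>{0<..<l2}. ennreal \<bar>F n (0, y)\<bar> \<partial>lborel)
      + (\<integral>\<^sup>+ p\<in>{0<..<l1} \<times> {0<..<l2}. ennreal \<bar>D1 n p - d1 p\<bar> \<partial>lborel)
      + (\<integral>\<^sup>+ p\<in>{0<..<l1} \<times> {0<..<l2}. ennreal \<bar>D2 n p - d2 p\<bar> \<partial>lborel)) \<longlonglongrightarrow> 0 + 0 + 0"
      by (intro tendsto_add lim)
    then show "(\<lambda>n. (\<integral>\<^sup>+ y\<in>{0<..<l2}. ennreal \<bar>F n (0, y)\<bar> \<partial>lborel)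
      + (\<integral>\<^sup>+ p\<in>{0<..<l1} \<times> {0<..<l2}. ennreal \<bar>D1 n p - d1 p\<bar> \<partial>lborel)
      + (\<integral>\<^sup>+ p\<in>{0<..<l1} \<times> {0<..<l2}. ennreal \<bar>D2 n p - d2 p\<bar> \<partial>lborel)) \<longlonglongrightarrow> 0"
      by simp
    show "(\<integral>\<^sup>+ y\<in>{h<..<l2 - h}. ennreal \<bar>F n (slant t h y s) - slant_int t h d1 d2 y s\<bar> \<partial>lborel)
      \<le> (\<integral>\<^sup>+ y\<in>{0<..<l2}. ennreal \<bar>F n (0, y)\<bar> \<partial>lborel)
      + (\<integral>\<^sup>+ p\<in>{0<..<l1} \<times> {0<..<l2}. ennreal \<bar>D1 n p - d1 p\<bar> \<partial>lborel)
      + (\<integral>\<^sup>+ p\<in>{0<..<l1} \<times> {0<..<l2}. ennreal \<bar>D2 n p - d2 p\<bar> \<partial>lborel)"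
      if "\<bar>t\<bar> \<le> 1" "0 \<le> s" "s \<le> h" for n t s
      by (rule slant_int_error[OF D F d fin that(2,3) h that(1)])
  qed (fact lim)
qed

lemma ennreal_zero_if_le_null_sequence:
  fixes a :: ennreal
  assumes "\<And>n. a \<le> X n" "X \<longlonglongrightarrow> 0"
  shows "a = 0"
  using LIMSEQ_le_const[OF assms(2), of a] assms(1) by auto

lemma zero_edge_H1_AE_slant:
  assumes f: "zero_edge_H1 l1 l2 f d1 d2" and h: "0 < h" "h \<le> l1" and t: "\<bar>t\<bar> \<le> 1"
  shows "AE y in lborel. y \<in> {h<..<l2 - h} \<longrightarrow>
    (AE s in lborel. s \<in> {0<..<h} \<longrightarrow> f (slant t h y s) = slant_int t h d1 d2 y s)"
proof -
  have [measurable]: "f \<in> borel_measurable borel" "d1 \<in> borel_measurable borel" "d2 \<in> borel_measurable borel"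
    using f unfolding zero_edge_H1_def by auto
  obtain F \<delta> where [measurable]: "\<And>n. F n \<in> borel_measurable borel" and \<delta>: "\<delta> \<longlonglongrightarrow> 0"
    and lim: "(\<lambda>n. \<integral>\<^sup>+ p\<in>{0<..<l1} \<times> {0<..<l2}. ennreal \<bar>F n p - f p\<bar> \<partial>lborel) \<longlonglongrightarrow> 0"
    and le: "\<And>n t s. \<bar>t\<bar> \<le> 1 \<Longrightarrow> 0 \<le> s \<Longrightarrow> s \<le> h \<Longrightarrow>
      (\<integral>\<^sup>+ y\<in>{h<..<l2 - h}. ennreal \<bar>F n (slant t h y s) - slant_int t h d1 d2 y s\<bar> \<partial>lborel) \<le> \<delta> n"
    using zero_edge_H1_approx[OF f h(2)] by blast
  let ?X = "\<integral>\<^sup>+ y. (\<integral>\<^sup>+ s. ennreal \<bar>f (slant t h y s) - slant_int t h d1 d2 y s\<bar>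
      * indicator {0<..<h} s * indicator {h<..<l2 - h} y \<partial>lborel) \<partial>lborel"
  have "?X \<le> (\<integral>\<^sup>+ p\<in>{0<..<l1} \<times> {0<..<l2}. ennreal \<bar>F n p - f p\<bar> \<partial>lborel) + ennreal h * \<delta> n" for n
  proof -
    let ?A = "\<lambda>y s. ennreal \<bar>F n (slant t h y s) - f (slant t h y s)\<bar> * indicator {0<..<h} s * indicator {h<..<l2 - h} y"
    let ?B = "\<lambda>y s. ennreal \<bar>F n (slant t h y s) - slant_int t h d1 d2 y s\<bar> * indicator {h<..<l2 - h} y * indicator {0<..<h} s"
    have "?X \<le> (\<integral>\<^sup>+ y. (\<integral>\<^sup>+ s. ?A y s + ?B y s \<partial>lborel) \<partial>lborel)"
      by (intro nn_integral_mono) (auto simp: indicator_def ennreal_leI simp flip: ennreal_plus)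
    also have "\<dots> = (\<integral>\<^sup>+ y. (\<integral>\<^sup>+ s. ?A y s \<partial>lborel) \<partial>lborel) + (\<integral>\<^sup>+ y. (\<integral>\<^sup>+ s. ?B y s \<partial>lborel) \<partial>lborel)"
      by (subst nn_integral_add[symmetric]) (auto intro!: nn_integral_cong nn_integral_add)
    also have "(\<integral>\<^sup>+ y. (\<integral>\<^sup>+ s. ?A y s \<partial>lborel) \<partial>lborel)
        = (\<integral>\<^sup>+ y\<in>{h<..<l2 - h}. (\<integral>\<^sup>+ s\<in>{0<..<h}. ennreal \<bar>F n (slant t h y s) - f (slant t h y s)\<bar> \<partial>lborel) \<partial>lborel)"
      by (intro nn_integral_cong nn_integral_multc) auto
    also have "\<dots> \<le> (\<integral>\<^sup>+ p\<in>{0<..<l1} \<times> {0<..<l2}. ennreal \<bar>F n p - f p\<bar> \<partial>lborel)"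
      by (rule nn_integral_slant_le[OF _ h(2) t, where f="\<lambda>p. ennreal \<bar>F n p - f p\<bar>"]) measurable
    also have "(\<integral>\<^sup>+ y. (\<integral>\<^sup>+ s. ?B y s \<partial>lborel) \<partial>lborel) = (\<integral>\<^sup>+ s. (\<integral>\<^sup>+ y. ?B y s \<partial>lborel) \<partial>lborel)"
      by (rule lborel_pair.Fubini') measurable
    also have "\<dots> = (\<integral>\<^sup>+ s\<in>{0<..<h}. (\<integral>\<^sup>+ y\<in>{h<..<l2 - h}. ennreal \<bar>F n (slant t h y s) - slant_int t h d1 d2 y s\<bar> \<partial>lborel) \<partial>lborel)"
      by (intro nn_integral_cong nn_integral_multc) auto
    also have "\<dots> \<le> (\<integral>\<^sup>+ s. \<delta> n * indicator {0<..<h} s \<partial>lborel)"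
    proof (rule nn_integral_mono)
      fix s
      show "(\<integral>\<^sup>+ y\<in>{h<..<l2 - h}. ennreal \<bar>F n (slant t h y s) - slant_int t h d1 d2 y s\<bar> \<partial>lborel) * indicator {0<..<h} s
        \<le> \<delta> n * indicator {0<..<h} s"
        using le[OF t, of s n] by (cases "s \<in> {0<..<h}") auto
    qed
    also have "\<dots> = ennreal h * \<delta> n"
      using h by (simp add: nn_integral_cmult_indicator mult.commute)
    finally show ?thesis by (simp add: add_mono)
  qed
  moreover have "(\<lambda>n. (\<integral>\<^sup>+ p\<in>{0<..<l1} \<times> {0<..<l2}. ennreal \<bar>F n p - f p\<bar> \<partial>lborel) + ennreal h * \<delta> n) \<longlonglongrightarrow> 0 + ennreal h * 0"
    by (intro tendsto_add lim ennreal_tendsto_cmult \<delta>) auto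
  ultimately have "?X = 0" by (intro ennreal_zero_if_le_null_sequence) auto
  then have "AE y in lborel. (\<integral>\<^sup>+ s. ennreal \<bar>f (slant t h y s) - slant_int t h d1 d2 y s\<bar>
      * indicator {0<..<h} s * indicator {h<..<l2 - h} y \<partial>lborel) = 0"
    by (subst (asm) nn_integral_0_iff_AE) auto
  then show ?thesis
  proof (eventually_elim, intro impI)
    fix y assume y: "y \<in> {h<..<l2 - h}" and 0: "(\<integral>\<^sup>+ s. ennreal \<bar>f (slant t h y s) - slant_int t h d1 d2 y s\<bar>
      * indicator {0<..<h} s * indicator {h<..<l2 - h} y \<partial>lborel) = 0"
    then have "AE s in lborel. ennreal \<bar>f (slant t h y s) - slant_int t h d1 d2 y s\<bar>
      * indicator {0<..<h} s * indicator {h<..<l2 - h} y = 0"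
      by (subst (asm) nn_integral_0_iff_AE) auto
    then show "AE s in lborel. s \<in> {0<..<h} \<longrightarrow> f (slant t h y s) = slant_int t h d1 d2 y s"
      by eventually_elim (use y in \<open>auto simp: ennreal_eq_0_iff\<close>)
  qed
qed

text \<open>If \<open>u\<close> had well-defined values on the segment \<open>x = h\<close>, the two sides would be
  \<open>(u1 + u2) + (u1 - u2)\<close> and \<open>2 u1\<close> at \<open>(h, y)\<close>. The identity is shown by applying this to smooth
  approximations, whose values at \<open>(h, y)\<close> cancel before the limit is taken.\<close>
lemma slant_int_second_difference:
  assumes a: "zero_edge_H1 l1 l2 u1 a11 a12" and b: "zero_edge_H1 l1 l2 u2 a21 a22" and h: "0 < h" "h \<le> l1"
  shows "AE y in lborel. y \<in> {h<..<l2 - h} \<longrightarrow>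
    slant_int 1 h a11 a12 y h + slant_int 1 h a21 a22 y h
    + (slant_int (-1) h a11 a12 y h - slant_int (-1) h a21 a22 y h) = 2 * slant_int 0 h a11 a12 y h"
proof -
  have [measurable]: "a11 \<in> borel_measurable borel" "a12 \<in> borel_measurable borel"
     "a21 \<in> borel_measurable borel" "a22 \<in> borel_measurable borel"
    using a b unfolding zero_edge_H1_def by auto
  obtain F \<delta> where [measurable]: "\<And>n. F n \<in> borel_measurable borel" and \<delta>: "\<delta> \<longlonglongrightarrow> 0"
    and "(\<lambda>n. \<integral>\<^sup>+ p\<in>{0<..<l1} \<times> {0<..<l2}. ennreal \<bar>F n p - u1 p\<bar> \<partial>lborel) \<longlonglongrightarrow> 0"
    and le: "\<And>n t s. \<bar>t\<bar> \<le> 1 \<Longrightarrow> 0 \<le> s \<Longrightarrow> s \<le> h \<Longrightarrow>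
      (\<integral>\<^sup>+ y\<in>{h<..<l2 - h}. ennreal \<bar>F n (slant t h y s) - slant_int t h a11 a12 y s\<bar> \<partial>lborel) \<le> \<delta> n"
    using zero_edge_H1_approx[OF a h(2)] by blast
  obtain G \<epsilon> where [measurable]: "\<And>n. G n \<in> borel_measurable borel" and \<epsilon>: "\<epsilon> \<longlonglongrightarrow> 0"
    and "(\<lambda>n. \<integral>\<^sup>+ p\<in>{0<..<l1} \<times> {0<..<l2}. ennreal \<bar>G n p - u2 p\<bar> \<partial>lborel) \<longlonglongrightarrow> 0"
    and leG: "\<And>n t s. \<bar>t\<bar> \<le> 1 \<Longrightarrow> 0 \<le> s \<Longrightarrow> s \<le> h \<Longrightarrow>
      (\<integral>\<^sup>+ y\<in>{h<..<l2 - h}. ennreal \<bar>G n (slant t h y s) - slant_int t h a21 a22 y s\<bar> \<partial>lborel) \<le> \<epsilon> n"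
    using zero_edge_H1_approx[OF b h(2)] by blast
  let ?J = "\<lambda>y. slant_int 1 h a11 a12 y h + slant_int 1 h a21 a22 y h
    + (slant_int (-1) h a11 a12 y h - slant_int (-1) h a21 a22 y h) - 2 * slant_int 0 h a11 a12 y h"
  have end_point: "slant t h y h = (h, y)" for t y by (simp add: slant_def)
  have "(\<integral>\<^sup>+ y\<in>{h<..<l2 - h}. ennreal \<bar>?J y\<bar> \<partial>lborel) \<le> 4 * \<delta> n + 2 * \<epsilon> n" for n
  proof -
    let ?D = "\<lambda>t y. ennreal \<bar>F n (h, y) - slant_int t h a11 a12 y h\<bar> * indicator {h<..<l2 - h} y"
    let ?E = "\<lambda>t y. ennreal \<bar>G n (h, y) - slant_int t h a21 a22 y h\<bar> * indicator {h<..<l2 - h} y"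
    have D: "(\<integral>\<^sup>+ y. ?D t y \<partial>lborel) \<le> \<delta> n" and E: "(\<integral>\<^sup>+ y. ?E t y \<partial>lborel) \<le> \<epsilon> n" if "\<bar>t\<bar> \<le> 1" for t
      using le[OF that, of h n] leG[OF that, of h n] h by (auto simp: end_point)
    have "ennreal \<bar>?J y\<bar> * indicator {h<..<l2 - h} y
        \<le> ?D 1 y + ?E 1 y + (?D (-1) y + ?E (-1) y) + (?D 0 y + ?D 0 y)" for y
    proof (cases "y \<in> {h<..<l2 - h}")
      case True
      have "ennreal \<bar>?J y\<bar> \<le> ennreal (\<bar>F n (h, y) - slant_int 1 h a11 a12 y h\<bar> + \<bar>G n (h, y) - slant_int 1 h a21 a22 y h\<bar>
         + (\<bar>F n (h, y) - slant_int (-1) h a11 a12 y h\<bar> + \<bar>G n (h, y) - slant_int (-1) h a21 a22 y h\<bar>)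
         + (\<bar>F n (h, y) - slant_int 0 h a11 a12 y h\<bar> + \<bar>F n (h, y) - slant_int 0 h a11 a12 y h\<bar>))"
        by (intro ennreal_leI) linarith
      then show ?thesis
        using True by (simp only: ennreal_plus abs_ge_zero add_nonneg_nonneg indicator_simps mult_1_right)
    qed auto
    then have "(\<integral>\<^sup>+ y\<in>{h<..<l2 - h}. ennreal \<bar>?J y\<bar> \<partial>lborel)
      \<le> (\<integral>\<^sup>+ y. ?D 1 y + ?E 1 y + (?D (-1) y + ?E (-1) y) + (?D 0 y + ?D 0 y) \<partial>lborel)"
      by (rule nn_integral_mono)
    also have "\<dots> = (\<integral>\<^sup>+ y. ?D 1 y \<partial>lborel) + (\<integral>\<^sup>+ y. ?E 1 y \<partial>lborel)
       + ((\<integral>\<^sup>+ y. ?D (-1) y \<partial>lborel) + (\<integral>\<^sup>+ y. ?E (-1) y \<partial>lborel)) + ((\<integral>\<^sup>+ y. ?D 0 y \<partial>lborel) + (\<integral>\<^sup>+ y. ?D 0 y \<partial>lborel))"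
      by (simp add: nn_integral_add)
    also have "\<dots> \<le> \<delta> n + \<epsilon> n + (\<delta> n + \<epsilon> n) + (\<delta> n + \<delta> n)"
      by (intro add_mono D E) auto
    also have "\<dots> = 4 * \<delta> n + 2 * \<epsilon> n"
      by (simp add: algebra_simps flip: mult_2 numeral_2_eq_2)
    finally show ?thesis .
  qed
  moreover have "(\<lambda>n. 4 * \<delta> n + 2 * \<epsilon> n) \<longlonglongrightarrow> 4 * 0 + 2 * 0"
    by (intro tendsto_add ennreal_tendsto_cmult \<delta> \<epsilon>) auto
  ultimately have "(\<integral>\<^sup>+ y\<in>{h<..<l2 - h}. ennreal \<bar>?J y\<bar> \<partial>lborel) = 0"
    by (intro ennreal_zero_if_le_null_sequence) auto
  then have "AE y in lborel. ennreal \<bar>?J y\<bar> * indicator {h<..<l2 - h} y = 0"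
    by (subst (asm) nn_integral_0_iff_AE) auto
  then show ?thesis
    by eventually_elim (auto simp: ennreal_eq_0_iff)
qed

section \<open>From trade-offs on a line to a bound\<close>

lemma bending_alone_bound:
  fixes a B :: ennreal
  assumes h: "0 < h" and K: "0 < K" and a: "a \<le> ennreal h" and B: "ennreal (h / 8) \<le> a\<^sup>2 * B"
  shows "ennreal (K / (8 * h)) \<le> ennreal K * B"
proof (cases B)
  case (real b)
  obtain a' where a': "a = ennreal a'" "0 \<le> a'" "a' \<le> h"
    using a h by (cases a) (auto simp: top_unique)
  have "h / 8 \<le> a'\<^sup>2 * b"
    using B real a' by (simp add: ennreal_power ennreal_mult'[symmetric])
  also have "\<dots> \<le> h\<^sup>2 * b"
    using a' real by (intro mult_right_mono power_mono) auto
  finally have "1 / (8 * h) \<le> b" using h by (simp add: field_simps power2_eq_square)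
  then have "K * (1 / (8 * h)) \<le> K * b" using K by (intro mult_left_mono) auto
  then show ?thesis using K real by (simp add: ennreal_mult'[symmetric] ennreal_leI)
next
  case top
  then show ?thesis using K by (simp add: ennreal_mult_top)
qed

text \<open>If both terms on the right were below \<open>m\<close>, then \<open>(\<gamma> a)\<^sup>2 (K B)\<close> would be below \<open>m\<^sup>3\<close>; but
  \<open>a\<close> drops out of the product because \<open>a\<^sup>2 B \<ge> h / 8\<close>.\<close>
lemma bending_delamination_bound:
  fixes a B :: ennreal
  assumes h: "0 < h" and K: "0 < K" and \<gamma>: "0 \<le> \<gamma>" and a: "a \<le> ennreal h" and B: "ennreal (h / 8) \<le> a\<^sup>2 * B"
    and m: "0 \<le> m" "m ^ 3 \<le> \<gamma>\<^sup>2 * K * h / 8"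
  shows "ennreal m \<le> ennreal \<gamma> * a + ennreal K * B"
proof (cases B)
  case (real b)
  obtain a' where a': "a = ennreal a'" "0 \<le> a'"
    using a h by (cases a) (auto simp: top_unique)
  have hb: "h / 8 \<le> a'\<^sup>2 * b"
    using B real a' by (simp add: ennreal_power ennreal_mult'[symmetric])
  have "m \<le> \<gamma> * a' + K * b"
  proof (rule ccontr)
    assume n: "\<not> m \<le> \<gamma> * a' + K * b"
    have p: "0 \<le> \<gamma> * a'" "0 \<le> K * b" using \<gamma> K a' real by auto
    have "\<gamma>\<^sup>2 * K * h / 8 = \<gamma>\<^sup>2 * K * (h / 8)" by simp
    also have "\<dots> \<le> \<gamma>\<^sup>2 * K * (a'\<^sup>2 * b)"
      using hb K by (intro mult_left_mono) auto
    also have "\<dots> = (\<gamma> * a')\<^sup>2 * (K * b)" by (simp add: power_mult_distrib)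
    also have "\<dots> \<le> m\<^sup>2 * (K * b)" using n p by (intro mult_right_mono power_mono) auto
    also have "\<dots> < m\<^sup>2 * m" using n p by (intro mult_strict_left_mono) auto
    also have "\<dots> = m ^ 3" by (simp add: power2_eq_square power3_eq_cube)
    finally show False using m by simp
  qed
  then show ?thesis
    using K \<gamma> a' real by (simp add: ennreal_mult'[symmetric] ennreal_leI flip: ennreal_plus)
next
  case top
  then show ?thesis using K by (simp add: ennreal_mult_top)
qed

section \<open>Membrane energy or slope on almost every line\<close>

definition slant_nn_int :: "real \<Rightarrow> real \<Rightarrow> (real \<times> real \<Rightarrow> ennreal) \<Rightarrow> real \<Rightarrow> ennreal" where
  "slant_nn_int t h f y = (\<integral>\<^sup>+ s\<in>{0<..<h}. f (slant t h y s) \<partial>lborel)"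

text \<open>In \<open>aij\<close> the first index is the component of \<open>u\<close> and the second one the direction of
  differentiation; \<open>wij\<close> is the derivative of \<open>wi\<close> in direction \<open>j\<close>.\<close>
locale clamped_film =
  fixes l1 l2 :: real
    and u1 u2 a11 a12 a21 a22 w w1 w2 w11 w12 w21 w22 :: "real \<times> real \<Rightarrow> real"
  assumes u1: "zero_edge_H1 l1 l2 u1 a11 a12"
    and u2: "zero_edge_H1 l1 l2 u2 a21 a22"
    and w: "zero_edge_H1 l1 l2 w w1 w2"
    and w1: "zero_edge_H1 l1 l2 w1 w11 w12"
    and w2: "zero_edge_H1 l1 l2 w2 w21 w22"
    and nonneg: "AE p in lborel. p \<in> {0<..<l1} \<times> {0<..<l2} \<longrightarrow> 0 \<le> w p"
begin

lemma film_measurable [measurable]: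
  "a11 \<in> borel_measurable borel" "a12 \<in> borel_measurable borel"
  "a21 \<in> borel_measurable borel" "a22 \<in> borel_measurable borel" "w \<in> borel_measurable borel"
  "w1 \<in> borel_measurable borel" "w2 \<in> borel_measurable borel"
  "w11 \<in> borel_measurable borel" "w12 \<in> borel_measurable borel"
  "w21 \<in> borel_measurable borel" "w22 \<in> borel_measurable borel"
  using u1 u2 w w1 w2 unfolding zero_edge_H1_def by auto

definition e11 :: "real \<times> real \<Rightarrow> real" where "e11 p = 2 * a11 p + (w1 p)\<^sup>2 - 1"
definition e12 :: "real \<times> real \<Rightarrow> real" where "e12 p = a12 p + a21 p + w1 p * w2 p"
definition e22 :: "real \<times> real \<Rightarrow> real" where "e22 p = 2 * a22 p + (w2 p)\<^sup>2 - 1"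

definition strain_sq :: "real \<times> real \<Rightarrow> real" where
  "strain_sq p = (e11 p)\<^sup>2 + 2 * (e12 p)\<^sup>2 + (e22 p)\<^sup>2"

definition hessian_sq :: "real \<times> real \<Rightarrow> real" where
  "hessian_sq p = (w11 p)\<^sup>2 + (w12 p)\<^sup>2 + (w21 p)\<^sup>2 + (w22 p)\<^sup>2"

text \<open>The quadratic form of the strain matrix at the direction \<open>(1, t)\<close>.\<close>
definition line_strain :: "real \<Rightarrow> real \<times> real \<Rightarrow> real" where
  "line_strain t p = e11 p + 2 * t * e12 p + t\<^sup>2 * e22 p"

lemma densities_measurable [measurable]:
  "e11 \<in> borel_measurable borel" "e12 \<in> borel_measurable borel" "e22 \<in> borel_measurable borel"
  "strain_sq \<in> borel_measurable borel" "hessian_sq \<in> borel_measurable borel"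
  "line_strain t \<in> borel_measurable borel"
proof -
  show [measurable]: "e11 \<in> borel_measurable borel" "e12 \<in> borel_measurable borel" "e22 \<in> borel_measurable borel"
    by (simp_all add: e11_def[abs_def] e12_def[abs_def] e22_def[abs_def])
  show "strain_sq \<in> borel_measurable borel" "hessian_sq \<in> borel_measurable borel" "line_strain t \<in> borel_measurable borel"
    by (simp_all add: strain_sq_def[abs_def] hessian_sq_def[abs_def] line_strain_def[abs_def])
qed

text \<open>The Cauchy-Schwarz inequality for the Frobenius inner product of the strain with
  \<open>\<tau> \<otimes> \<tau>\<close>, whose norm is \<open>1 + t\<^sup>2\<close>; the difference of the two sides is a sum of squares by Lagrange's
  identity.\<close>
lemma line_strain_sq_le:
  assumes "\<bar>t\<bar> \<le> 1"
  shows "(line_strain t p)\<^sup>2 \<le> (1 + t\<^sup>2)\<^sup>2 * strain_sq p"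
proof -
  have "(1 + t\<^sup>2)\<^sup>2 * strain_sq p - (line_strain t p)\<^sup>2
    = 2 * (e12 p - t * e11 p)\<^sup>2 + 2 * t\<^sup>2 * (e22 p * 1 - t * e12 p)\<^sup>2 + (e22 p - t\<^sup>2 * e11 p)\<^sup>2"
    unfolding strain_sq_def line_strain_def power2_eq_square by (simp add: algebra_simps)
  moreover have "\<dots> \<ge> 0" by simp
  ultimately show ?thesis by linarith
qed

lemma directional_hessian_sq_le:
  assumes "t\<^sup>2 = 1"
  shows "(w11 p + t * w21 p + t * (w12 p + t * w22 p))\<^sup>2 \<le> 4 * hessian_sq p"
proof -
  have four: "(a + b + c + d)\<^sup>2 \<le> 4 * (a\<^sup>2 + b\<^sup>2 + c\<^sup>2 + d\<^sup>2)" for a b c d :: real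
  proof -
    have "4 * (a\<^sup>2 + b\<^sup>2 + c\<^sup>2 + d\<^sup>2) - (a + b + c + d)\<^sup>2
      = (a - b)\<^sup>2 + (a - c)\<^sup>2 + (a - d)\<^sup>2 + (b - c)\<^sup>2 + (b - d)\<^sup>2 + (c - d)\<^sup>2"
      by (simp add: power2_eq_square algebra_simps)
    moreover have "\<dots> \<ge> 0" by simp
    ultimately show ?thesis by linarith
  qed
  have "w11 p + t * w21 p + t * (w12 p + t * w22 p) = w11 p + t * w12 p + t * w21 p + t\<^sup>2 * w22 p"
    by (simp add: algebra_simps power2_eq_square)
  also have "(w11 p + t * w12 p + t * w21 p + t\<^sup>2 * w22 p)\<^sup>2
      \<le> 4 * ((w11 p)\<^sup>2 + (t * w12 p)\<^sup>2 + (t * w21 p)\<^sup>2 + (t\<^sup>2 * w22 p)\<^sup>2)"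
    by (rule four)
  also have "\<dots> = 4 * hessian_sq p"
    using assms by (simp add: hessian_sq_def power_mult_distrib)
  finally show ?thesis .
qed

text \<open>The left-hand side is the increment of \<open>2 \<tau> \<cdot> u\<close> for \<open>\<tau> = (1, t)\<close>. Only the combination of
  derivatives of \<open>u\<close> that enters the strain in direction \<open>\<tau>\<close> occurs in it.\<close>
lemma line_balance:
  assumes t: "\<bar>t\<bar> \<le> 1" and h: "0 < h"
    and d: "\<And>d. d \<in> {a11, a12, a21, a22, w1, w2} \<Longrightarrow>
      (\<integral>\<^sup>+ s\<in>{0<..<h}. ennreal ((d (slant t h y s))\<^sup>2) \<partial>lborel) < \<infinity>"
  shows "2 * (slant_int t h a11 a12 y h + t * slant_int t h a21 a22 y h)
      = (LBINT s:{0<..<h}. line_strain t (slant t h y s))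
        - (LBINT s:{0<..<h}. (w1 (slant t h y s) + t * w2 (slant t h y s))\<^sup>2) + (1 + t\<^sup>2) * h"
    "set_integrable lborel {0<..<h} (\<lambda>s. line_strain t (slant t h y s))"
    "set_integrable lborel {0<..<h} (\<lambda>s. (w1 (slant t h y s) + t * w2 (slant t h y s))\<^sup>2)"
proof -
  let ?p = "slant t h y"
  have i: "set_integrable lborel {0<..<h} (\<lambda>s. d (?p s))" "set_integrable lborel {0<..<h} (\<lambda>s. (d (?p s))\<^sup>2)"
    if "d \<in> {a11, a12, a21, a22, w1, w2}" for d
    using square_integrable_on_interval[of "\<lambda>s. d (?p s)" h] d[OF that] that by auto
  note i1 = i(1)[of a11] i(1)[of a12] i(1)[of a21] i(1)[of a22]
  have sq: "(w1 p + t * w2 p)\<^sup>2 \<le> 2 * ((w1 p)\<^sup>2 + (w2 p)\<^sup>2)" for p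
  proof -
    have "t\<^sup>2 \<le> 1" using t by (simp add: abs_square_le_1)
    then have "t\<^sup>2 * (w2 p)\<^sup>2 \<le> 1 * (w2 p)\<^sup>2" by (rule mult_right_mono) simp
    moreover have "0 \<le> (w1 p - t * w2 p)\<^sup>2" by simp
    ultimately show ?thesis by (simp add: power2_sum power2_diff power_mult_distrib)
  qed
  have i2: "set_integrable lborel {0<..<h} (\<lambda>s. 2 * ((w1 (?p s))\<^sup>2 + (w2 (?p s))\<^sup>2))"
    by (intro set_integral_add set_integrable_mult_right i) auto
  show i3: "set_integrable lborel {0<..<h} (\<lambda>s. (w1 (?p s) + t * w2 (?p s))\<^sup>2)"
    unfolding set_integrable_def
    by (rule Bochner_Integration.integrable_bound[OF i2[unfolded set_integrable_def]])
       (use sq in \<open>auto simp: indicator_def, measurable\<close>)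
  have c: "set_integrable lborel {0<..<h} (\<lambda>s. c)" for c :: real
    using h unfolding set_integrable_def by (simp add: integrable_indicator_iff)
  have cv: "(LBINT s:{0<..<h}. c) = c * h" for c :: real
    using h by (simp add: set_lebesgue_integral_def)
  let ?lin = "\<lambda>s. (a11 (?p s) + t * a12 (?p s)) + t * (a21 (?p s) + t * a22 (?p s))"
  have il: "set_integrable lborel {0<..<h} ?lin"
    by (intro set_integral_add set_integrable_mult_right i1) auto
  have eq: "line_strain t p = 2 * ((a11 p + t * a12 p) + t * (a21 p + t * a22 p)) + (w1 p + t * w2 p)\<^sup>2 - (1 + t\<^sup>2)" for p
    unfolding line_strain_def e11_def e12_def e22_def power2_eq_square by (simp add: algebra_simps)
  show "set_integrable lborel {0<..<h} (\<lambda>s. line_strain t (?p s))"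
    unfolding eq by (intro set_integral_add set_integral_diff set_integrable_mult_right il i3 c)
  have "(LBINT s:{0<..<h}. line_strain t (?p s))
     = 2 * (LBINT s:{0<..<h}. ?lin s) + (LBINT s:{0<..<h}. (w1 (?p s) + t * w2 (?p s))\<^sup>2) - (1 + t\<^sup>2) * h"
  proof -
    have il2: "set_integrable lborel {0<..<h} (\<lambda>s. 2 * ?lin s)"
      by (intro set_integrable_mult_right il)
    have "(LBINT s:{0<..<h}. line_strain t (?p s))
        = (LBINT s:{0<..<h}. 2 * ?lin s + (w1 (?p s) + t * w2 (?p s))\<^sup>2) - (LBINT s:{0<..<h}. 1 + t\<^sup>2)"
      unfolding eq by (rule set_integral_diff(2)[OF set_integral_add(1)[OF il2 i3] c])
    also have "\<dots> = (LBINT s:{0<..<h}. 2 * ?lin s) + (LBINT s:{0<..<h}. (w1 (?p s) + t * w2 (?p s))\<^sup>2)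
        - (LBINT s:{0<..<h}. 1 + t\<^sup>2)"
      by (simp only: set_integral_add(2)[OF il2 i3])
    finally show ?thesis by (simp only: cv set_integral_mult_right)
  qed
  moreover have "(LBINT s:{0<..<h}. ?lin s) = slant_int t h a11 a12 y h + t * slant_int t h a21 a22 y h"
    unfolding slant_int_def
    by (subst set_integral_add(2)) (auto intro!: set_integral_add set_integrable_mult_right i1)
  ultimately show "2 * (slant_int t h a11 a12 y h + t * slant_int t h a21 a22 y h)
      = (LBINT s:{0<..<h}. line_strain t (?p s))
        - (LBINT s:{0<..<h}. (w1 (?p s) + t * w2 (?p s))\<^sup>2) + (1 + t\<^sup>2) * h"
    by simp
qed

text \<open>The threshold \<open>h / 36\<close> is chosen such that the errors of the three lines, with the horizontal
  one counted twice, add up to at most \<open>h / 3 + h / 3 + 2 h / 6 = h\<close>. This is half of the \<open>2 h\<close> that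
  the stretch provides.\<close>
lemma line_strain_integral_le:
  assumes t: "\<bar>t\<bar> \<le> 1" and h: "0 < h"
    and i: "set_integrable lborel {0<..<h} (\<lambda>s. line_strain t (slant t h y s))"
    and small: "slant_nn_int t h (\<lambda>p. ennreal (strain_sq p)) y < ennreal (h / 36)"
  shows "\<bar>LBINT s:{0<..<h}. line_strain t (slant t h y s)\<bar> \<le> (1 + t\<^sup>2) * h / 6"
proof -
  let ?p = "slant t h y"
  let ?I = "\<bar>LBINT s:{0<..<h}. line_strain t (?p s)\<bar>"
  have "ennreal ?I \<le> (\<integral>\<^sup>+ s. ennreal (norm (indicator {0<..<h} s *\<^sub>R line_strain t (?p s))) \<partial>lborel)"
    using integral_norm_bound_ennreal[OF i[unfolded set_integrable_def]]
    unfolding set_lebesgue_integral_def by simp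
  also have "\<dots> = (\<integral>\<^sup>+ s\<in>{0<..<h}. ennreal \<bar>line_strain t (?p s)\<bar> \<partial>lborel)"
    by (intro nn_integral_cong) (auto simp: indicator_def)
  finally have "(ennreal ?I)\<^sup>2 \<le> \<dots>\<^sup>2" by (rule power_mono) simp
  also have "\<dots> \<le> emeasure lborel {0<..<h} * (\<integral>\<^sup>+ s\<in>{0<..<h}. ennreal ((line_strain t (?p s))\<^sup>2) \<partial>lborel)"
    by (rule set_nn_integral_abs_power2_le) measurable
  also have "emeasure lborel {0<..<h} = ennreal h" using h by simp
  also have "(\<integral>\<^sup>+ s\<in>{0<..<h}. ennreal ((line_strain t (?p s))\<^sup>2) \<partial>lborel)
     \<le> (\<integral>\<^sup>+ s. ennreal ((1 + t\<^sup>2)\<^sup>2) * (ennreal (strain_sq (?p s)) * indicator {0<..<h} s) \<partial>lborel)"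
    by (intro nn_integral_mono)
       (auto simp: indicator_def ennreal_mult'[symmetric] intro!: ennreal_leI line_strain_sq_le t)
  also have "\<dots> = ennreal ((1 + t\<^sup>2)\<^sup>2) * slant_nn_int t h (\<lambda>p. ennreal (strain_sq p)) y"
    unfolding slant_nn_int_def by (rule nn_integral_cmult) measurable
  also have "\<dots> \<le> ennreal ((1 + t\<^sup>2)\<^sup>2) * ennreal (h / 36)"
    using small by (intro mult_left_mono) auto
  finally have "ennreal (?I\<^sup>2) \<le> ennreal (h * ((1 + t\<^sup>2)\<^sup>2 * (h / 36)))"
    using h by (simp add: ennreal_power ennreal_mult'[symmetric] mult_left_mono)
  then have "?I\<^sup>2 \<le> h * ((1 + t\<^sup>2)\<^sup>2 * (h / 36))"
    using h by (subst (asm) ennreal_le_iff) auto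
  also have "\<dots> = ((1 + t\<^sup>2) * h / 6)\<^sup>2" by (simp add: power2_eq_square)
  finally show ?thesis
    by (rule power2_le_imp_le) (use h in simp)
qed

definition line_square_integrable :: "real \<Rightarrow> real \<Rightarrow> real \<Rightarrow> bool" where
  "line_square_integrable t h y \<longleftrightarrow>
    (\<forall>d \<in> {a11, a12, a21, a22, w1, w2, w11, w12, w21, w22}.
      (\<integral>\<^sup>+ s\<in>{0<..<h}. ennreal ((d (slant t h y s))\<^sup>2) \<partial>lborel) < \<infinity>)"

lemma AE_line_square_integrable:
  assumes h: "0 < h" "h \<le> l1" and t: "\<bar>t\<bar> \<le> 1"
  shows "AE y in lborel. y \<in> {h<..<l2 - h} \<longrightarrow>
    line_square_integrable t h y"
proof -
  have "AE y in lborel. \<forall>d \<in> {a11, a12, a21, a22, w1, w2, w11, w12, w21, w22}. y \<in> {h<..<l2 - h} \<longrightarrow>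
      (\<integral>\<^sup>+ s\<in>{0<..<h}. ennreal ((d (slant t h y s))\<^sup>2) \<partial>lborel) < \<infinity>"
  proof (rule AE_finite_allI)
    fix d assume "d \<in> {a11, a12, a21, a22, w1, w2, w11, w12, w21, w22}"
    then have "d \<in> borel_measurable borel \<and> (\<integral>\<^sup>+ p\<in>{0<..<l1} \<times> {0<..<l2}. ennreal ((d p)\<^sup>2) \<partial>lborel) < \<infinity>"
      using zero_edge_H1_square_integrable[OF u1] zero_edge_H1_square_integrable[OF u2]
        zero_edge_H1_square_integrable[OF w] zero_edge_H1_square_integrable[OF w1]
        zero_edge_H1_square_integrable[OF w2] film_measurable
      by (elim insertE emptyE; simp only:)
    then have "d \<in> borel_measurable borel" "(\<integral>\<^sup>+ p\<in>{0<..<l1} \<times> {0<..<l2}. ennreal ((d p)\<^sup>2) \<partial>lborel) < \<infinity>"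
      by auto
    then show "AE y in lborel. y \<in> {h<..<l2 - h} \<longrightarrow>
      (\<integral>\<^sup>+ s\<in>{0<..<h}. ennreal ((d (slant t h y s))\<^sup>2) \<partial>lborel) < \<infinity>"
      by (rule AE_slant_square_integrable[OF _ _ h(2) t])
  qed simp
  then show ?thesis
    unfolding line_square_integrable_def by eventually_elim blast
qed

text \<open>Taking the second difference of \<open>line_balance\<close> over the slopes \<open>1, 0, -1\<close> eliminates \<open>u\<close>. The
  slope integral of the horizontal line has a favourable sign, and only the two slanted ones remain to
  balance \<open>2 h\<close>.\<close>
lemma membrane_or_slope:
  assumes h: "0 < h" "h \<le> l1"
  shows "AE y in lborel. y \<in> {h<..<l2 - h} \<longrightarrow>
    (\<exists>t\<in>{-1, 0, 1}. ennreal (h / 36) \<le> slant_nn_int t h (\<lambda>p. ennreal (strain_sq p)) y) \<or>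
    (\<exists>t\<in>{-1, 1}. ennreal (h / 2) \<le> slant_nn_int t h (\<lambda>p. ennreal ((w1 p + t * w2 p)\<^sup>2)) y)"
proof -
  have abs1: "\<bar>t\<bar> \<le> 1" if "t \<in> {-1, 0, 1}" for t :: real using that by auto
  have si: "AE y in lborel. y \<in> {h<..<l2 - h} \<longrightarrow> line_square_integrable 1 h y"
    "AE y in lborel. y \<in> {h<..<l2 - h} \<longrightarrow> line_square_integrable (-1) h y"
    "AE y in lborel. y \<in> {h<..<l2 - h} \<longrightarrow> line_square_integrable 0 h y"
    by (rule AE_line_square_integrable[OF h], simp)+
  show ?thesis
    using slant_int_second_difference[OF u1 u2 h] si
  proof (eventually_elim, intro impI)
    fix y assume y: "y \<in> {h<..<l2 - h}"
      and bal: "y \<in> {h<..<l2 - h} \<longrightarrow> slant_int 1 h a11 a12 y h + slant_int 1 h a21 a22 y h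
        + (slant_int (-1) h a11 a12 y h - slant_int (-1) h a21 a22 y h) = 2 * slant_int 0 h a11 a12 y h"
      and fin: "y \<in> {h<..<l2 - h} \<longrightarrow> line_square_integrable 1 h y"
        "y \<in> {h<..<l2 - h} \<longrightarrow> line_square_integrable (-1) h y"
        "y \<in> {h<..<l2 - h} \<longrightarrow> line_square_integrable 0 h y"
    define R where "R t = (LBINT s:{0<..<h}. line_strain t (slant t h y s))" for t
    define G where "G t = (LBINT s:{0<..<h}. (w1 (slant t h y s) + t * w2 (slant t h y s))\<^sup>2)" for t
    have fin': "(\<integral>\<^sup>+ s\<in>{0<..<h}. ennreal ((d (slant t h y s))\<^sup>2) \<partial>lborel) < \<infinity>"
      if "t \<in> {-1, 0, 1}" "d \<in> {a11, a12, a21, a22, w1, w2}" for t d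
      using fin y that unfolding line_square_integrable_def by auto
    have lb: "2 * (slant_int t h a11 a12 y h + t * slant_int t h a21 a22 y h) = R t - G t + (1 + t\<^sup>2) * h"
        "set_integrable lborel {0<..<h} (\<lambda>s. line_strain t (slant t h y s))"
        "set_integrable lborel {0<..<h} (\<lambda>s. (w1 (slant t h y s) + t * w2 (slant t h y s))\<^sup>2)"
      if "t \<in> {-1, 0, 1}" for t
      using line_balance[OF abs1[OF that] h(1) fin'[OF that]] unfolding R_def G_def by blast+
    have G0: "0 \<le> G t" for t
      unfolding G_def set_lebesgue_integral_def by (rule integral_nonneg_AE) (auto simp: indicator_def)
    have sum: "G 1 + G (-1) = 2 * h + 2 * G 0 + R 1 + R (-1) - 2 * R 0"
    proof -
      have "2 * (slant_int 1 h a11 a12 y h + slant_int 1 h a21 a22 y h) = R 1 - G 1 + 2 * h"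
        "2 * (slant_int (-1) h a11 a12 y h - slant_int (-1) h a21 a22 y h) = R (-1) - G (-1) + 2 * h"
        "2 * slant_int 0 h a11 a12 y h = R 0 - G 0 + h"
        using lb(1)[of 1] lb(1)[of "-1"] lb(1)[of 0] by simp_all
      moreover have "slant_int 1 h a11 a12 y h + slant_int 1 h a21 a22 y h
        + (slant_int (-1) h a11 a12 y h - slant_int (-1) h a21 a22 y h) = 2 * slant_int 0 h a11 a12 y h"
        using bal y by blast
      ultimately show ?thesis by argo
    qed
    show "(\<exists>t\<in>{-1, 0, 1}. ennreal (h / 36) \<le> slant_nn_int t h (\<lambda>p. ennreal (strain_sq p)) y) \<or>
      (\<exists>t\<in>{-1, 1}. ennreal (h / 2) \<le> slant_nn_int t h (\<lambda>p. ennreal ((w1 p + t * w2 p)\<^sup>2)) y)"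
    proof (cases "\<exists>t\<in>{-1, 0, 1}. ennreal (h / 36) \<le> slant_nn_int t h (\<lambda>p. ennreal (strain_sq p)) y")
      case False
      then have R: "\<bar>R t\<bar> \<le> (1 + t\<^sup>2) * h / 6" if "t \<in> {-1, 0, 1}" for t
        unfolding R_def using that by (intro line_strain_integral_le abs1 h lb(2)) (blast intro: not_le_imp_less)+
      have "h \<le> G 1 + G (-1)"
      proof -
        have "\<bar>R 1\<bar> \<le> h / 3" "\<bar>R (-1)\<bar> \<le> h / 3" "\<bar>R 0\<bar> \<le> h / 6"
          using R[of 1] R[of "-1"] R[of 0] by simp_all
        then show ?thesis using sum G0[of 0] by linarith
      qed
      then have "h / 2 \<le> G (-1) \<or> h / 2 \<le> G 1" by linarith
      then obtain t where t: "t \<in> {-1, 1}" "h / 2 \<le> G t" by blast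
      have "slant_nn_int t h (\<lambda>p. ennreal ((w1 p + t * w2 p)\<^sup>2)) y = ennreal (G t)"
      proof -
        have "ennreal (G t) = (\<integral>\<^sup>+ s. ennreal (indicator {0<..<h} s *\<^sub>R (w1 (slant t h y s) + t * w2 (slant t h y s))\<^sup>2) \<partial>lborel)"
          unfolding G_def set_lebesgue_integral_def
          by (rule nn_integral_eq_integral[symmetric])
             (use lb(3)[of t] t(1) in \<open>force simp: set_integrable_def\<close>, simp)
        also have "\<dots> = slant_nn_int t h (\<lambda>p. ennreal ((w1 p + t * w2 p)\<^sup>2)) y"
          unfolding slant_nn_int_def by (intro nn_integral_cong) (auto simp: indicator_def)
        finally show ?thesis by simp
      qed
      then have "\<exists>t\<in>{-1, 1}. ennreal (h / 2) \<le> slant_nn_int t h (\<lambda>p. ennreal ((w1 p + t * w2 p)\<^sup>2)) y"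
        using t by (intro bexI[of _ t]) (auto intro: ennreal_leI)
      then show ?thesis ..
    qed (rule disjI1)
  qed
qed

text \<open>On almost every line, \<open>w\<close> and its slope along the line are successive primitives, starting from
  zero, of the second derivative along the line, so \<open>slope_energy_bound\<close> applies. The set \<open>w \<noteq> 0\<close> in it
  becomes \<open>w > 0\<close> by the sign condition.\<close>
lemma line_slope_bound:
  assumes h: "0 < h" "h \<le> l1" and t: "t \<in> {-1, 1}"
  shows "AE y in lborel. y \<in> {h<..<l2 - h} \<longrightarrow>
    slant_nn_int t h (\<lambda>p. ennreal ((w1 p + t * w2 p)\<^sup>2)) y
    \<le> 4 * ((slant_nn_int t h (indicator {p. 0 < w p}) y)\<^sup>2 * slant_nn_int t h (\<lambda>p. ennreal (hessian_sq p)) y)"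
proof -
  have t1: "\<bar>t\<bar> \<le> 1" "t\<^sup>2 = 1" using t by auto
  show ?thesis
    using zero_edge_H1_AE_slant[OF w h t1(1)] zero_edge_H1_AE_slant[OF w1 h t1(1)]
      zero_edge_H1_AE_slant[OF w2 h t1(1)] AE_slant[OF nonneg h(2) t1(1)]
      AE_line_square_integrable[OF h t1(1)]
  proof (eventually_elim, intro impI)
    fix y assume y: "y \<in> {h<..<l2 - h}"
      and ws: "y \<in> {h<..<l2 - h} \<longrightarrow> (AE s in lborel. s \<in> {0<..<h} \<longrightarrow> w (slant t h y s) = slant_int t h w1 w2 y s)"
        "y \<in> {h<..<l2 - h} \<longrightarrow> (AE s in lborel. s \<in> {0<..<h} \<longrightarrow> w1 (slant t h y s) = slant_int t h w11 w12 y s)"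
        "y \<in> {h<..<l2 - h} \<longrightarrow> (AE s in lborel. s \<in> {0<..<h} \<longrightarrow> w2 (slant t h y s) = slant_int t h w21 w22 y s)"
        "y \<in> {h<..<l2 - h} \<longrightarrow> (AE s in lborel. s \<in> {0<..<h} \<longrightarrow> 0 \<le> w (slant t h y s))"
      and fin: "y \<in> {h<..<l2 - h} \<longrightarrow> line_square_integrable t h y"
    let ?p = "slant t h y"
    define k where "k s = w11 (?p s) + t * w12 (?p s) + t * (w21 (?p s) + t * w22 (?p s))" for s
    have i: "set_integrable lborel {0<..<h} (\<lambda>s. d (?p s))" if "d \<in> {w11, w12, w21, w22}" for d
      using square_integrable_on_interval(2)[of "\<lambda>s. d (?p s)" h] fin y that unfolding line_square_integrable_def by auto
    note i' = i[of w11, simplified] i[of w12, simplified] i[of w21, simplified] i[of w22, simplified]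
    have ki: "set_integrable lborel {0<..<h} k"
      unfolding k_def by (intro set_integral_add set_integrable_mult_right i')
    have km [measurable]: "k \<in> borel_measurable borel" unfolding k_def by measurable
    define g where "g s = (LBINT r:{0<..<s}. k r)" for s
    define f where "f s = (LBINT r:{0<..<s}. g r)" for s
    have g: "AE s in lborel. s \<in> {0<..<h} \<longrightarrow> w1 (?p s) + t * w2 (?p s) = g s"
      using ws(2)[rule_format, OF y] ws(3)[rule_format, OF y]
    proof eventually_elim
      case (elim s)
      show ?case
      proof
        assume s: "s \<in> {0<..<h}"
        have j: "set_integrable lborel {0<..<s} (\<lambda>s. d (?p s))" if "d \<in> {w11, w12, w21, w22}" for d
          by (rule set_integrable_subset[OF i[OF that]]) (use s in auto)
        note j' = j[of w11, simplified] j[of w12, simplified] j[of w21, simplified] j[of w22, simplified]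
        have "g s = slant_int t h w11 w12 y s + t * slant_int t h w21 w22 y s"
          unfolding g_def k_def slant_int_def
          by (subst set_integral_add(2)) (auto intro!: set_integral_add set_integrable_mult_right j')
        then show "w1 (?p s) + t * w2 (?p s) = g s" using elim s by simp
      qed
    qed
    have f: "slant_int t h w1 w2 y s = f s" if "s \<in> {0<..<h}" for s
      unfolding f_def slant_int_def set_lebesgue_integral_def
    proof (rule integral_cong_AE)
      have "continuous_on {0..h} g"
        unfolding g_def by (rule continuous_on_primitive[OF ki]) (use h in simp)
      then have "continuous_on {0<..<s} g"
        by (rule continuous_on_subset) (use that in auto)
      then show "(\<lambda>r. indicator {0<..<s} r *\<^sub>R g r) \<in> borel_measurable lborel"
        using borel_measurable_continuous_on_indicator[of "{0<..<s}" g] by simp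
      show "AE r in lborel. indicator {0<..<s} r *\<^sub>R (w1 (?p r) + t * w2 (?p r)) = indicator {0<..<s} r *\<^sub>R g r"
        using g by eventually_elim (use that in \<open>auto simp: indicator_def\<close>)
    qed measurable
    have slope: "slant_nn_int t h (\<lambda>p. ennreal ((w1 p + t * w2 p)\<^sup>2)) y = (\<integral>\<^sup>+ s\<in>{0<..<h}. ennreal ((g s)\<^sup>2) \<partial>lborel)"
      unfolding slant_nn_int_def
      by (rule nn_integral_cong_AE, use g in eventually_elim) (auto simp: indicator_def)
    have bound: "(\<integral>\<^sup>+ s\<in>{0<..<h}. ennreal ((g s)\<^sup>2) \<partial>lborel)
      \<le> (emeasure lborel {s \<in> {0<..<h}. f s \<noteq> 0})\<^sup>2 * (\<integral>\<^sup>+ s\<in>{0<..<h}. ennreal ((k s)\<^sup>2) \<partial>lborel)"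
      unfolding f_def g_def by (rule slope_energy_bound[OF _ ki km]) (use h in simp)
    have area: "emeasure lborel {s \<in> {0<..<h}. f s \<noteq> 0} \<le> slant_nn_int t h (indicator {p. 0 < w p}) y"
    proof -
      have "emeasure lborel {s \<in> {0<..<h}. f s \<noteq> 0} \<le> emeasure lborel {s \<in> {0<..<h}. 0 < w (?p s)}"
      proof (rule emeasure_mono_AE)
        show "AE s in lborel. s \<in> {s \<in> {0<..<h}. f s \<noteq> 0} \<longrightarrow> s \<in> {s \<in> {0<..<h}. 0 < w (?p s)}"
          using ws(1)[rule_format, OF y] ws(4)[rule_format, OF y]
          by eventually_elim (use f in force)
      qed measurable
      also have "\<dots> = (\<integral>\<^sup>+ s. indicator {s \<in> {0<..<h}. 0 < w (?p s)} s \<partial>lborel)"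
        by (rule nn_integral_indicator[symmetric]) measurable
      also have "\<dots> = slant_nn_int t h (indicator {p. 0 < w p}) y"
        unfolding slant_nn_int_def by (intro nn_integral_cong) (auto split: split_indicator)
      finally show ?thesis .
    qed
    have bend: "(\<integral>\<^sup>+ s\<in>{0<..<h}. ennreal ((k s)\<^sup>2) \<partial>lborel) \<le> 4 * slant_nn_int t h (\<lambda>p. ennreal (hessian_sq p)) y"
    proof -
      have "(\<integral>\<^sup>+ s\<in>{0<..<h}. ennreal ((k s)\<^sup>2) \<partial>lborel)
          \<le> (\<integral>\<^sup>+ s. 4 * (ennreal (hessian_sq (?p s)) * indicator {0<..<h} s) \<partial>lborel)"
      proof (rule nn_integral_mono)
        fix s
        have "(k s)\<^sup>2 \<le> 4 * hessian_sq (?p s)"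
          using directional_hessian_sq_le[OF t1(2), of "?p s"] unfolding k_def by (simp add: algebra_simps)
        then have "ennreal ((k s)\<^sup>2) \<le> 4 * ennreal (hessian_sq (?p s))"
          by (metis ennreal_leI ennreal_mult' ennreal_numeral zero_le_numeral)
        then show "ennreal ((k s)\<^sup>2) * indicator {0<..<h} s \<le> 4 * (ennreal (hessian_sq (?p s)) * indicator {0<..<h} s)"
          by (auto simp: indicator_def)
      qed
      also have "\<dots> = 4 * slant_nn_int t h (\<lambda>p. ennreal (hessian_sq p)) y"
        unfolding slant_nn_int_def by (rule nn_integral_cmult) measurable
      finally show ?thesis .
    qed
    let ?A = "slant_nn_int t h (indicator {p. 0 < w p}) y"
    let ?B = "slant_nn_int t h (\<lambda>p. ennreal (hessian_sq p)) y"
    note bound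
    also have "(emeasure lborel {s \<in> {0<..<h}. f s \<noteq> 0})\<^sup>2 * (\<integral>\<^sup>+ s\<in>{0<..<h}. ennreal ((k s)\<^sup>2) \<partial>lborel)
        \<le> ?A\<^sup>2 * (4 * ?B)"
      by (intro mult_mono power_mono area bend) auto
    also have "\<dots> = 4 * (?A\<^sup>2 * ?B)" by (simp only: mult.left_commute)
    finally show "slant_nn_int t h (\<lambda>p. ennreal ((w1 p + t * w2 p)\<^sup>2)) y \<le> 4 * (?A\<^sup>2 * ?B)"
      by (simp only: slope)
  qed
qed

section \<open>Integration over the end points\<close>

text \<open>The energy with \<open>K\<close> in place of the bending modulus \<open>(\<sigma> l1)\<^sup>2\<close>.\<close>
definition film_energy :: "real \<Rightarrow> real \<Rightarrow> ennreal" where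
  "film_energy K \<gamma> = (\<integral>\<^sup>+ p\<in>{0<..<l1} \<times> {0<..<l2}. ennreal (strain_sq p) \<partial>lborel)
    + ennreal K * (\<integral>\<^sup>+ p\<in>{0<..<l1} \<times> {0<..<l2}. ennreal (hessian_sq p) \<partial>lborel)
    + ennreal \<gamma> * (\<integral>\<^sup>+ p\<in>{0<..<l1} \<times> {0<..<l2}. indicator {p. 0 < w p} p \<partial>lborel)"

text \<open>The hypothesis \<open>opt\<close> is the outcome of the minimisation over the support length \<open>a\<close>. It is a
  parameter because the two choices of \<open>h\<close> use different minimisations.\<close>
lemma AE_line_energy_ge:
  fixes K \<gamma> m :: real
  assumes h: "0 < h" "h \<le> l1" and m: "m \<le> h / 36"
    and opt: "\<And>a B. a \<le> ennreal h \<Longrightarrow> ennreal (h / 8) \<le> a\<^sup>2 * B \<Longrightarrow> ennreal m \<le> ennreal \<gamma> * a + ennreal K * B"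
  defines "D \<equiv> \<lambda>p. ennreal (strain_sq p) + ennreal K * ennreal (hessian_sq p) + ennreal \<gamma> * indicator {p. 0 < w p} p"
  shows "AE y in lborel. y \<in> {h<..<l2 - h} \<longrightarrow>
    ennreal m \<le> slant_nn_int (-1) h D y + slant_nn_int 0 h D y + slant_nn_int 1 h D y"
  using membrane_or_slope[OF h] line_slope_bound[OF h, of "-1", simplified] line_slope_bound[OF h, of 1, simplified]
proof (eventually_elim, intro impI)
  fix y assume y: "y \<in> {h<..<l2 - h}"
    and dich: "y \<in> {h<..<l2 - h} \<longrightarrow> (\<exists>t\<in>{-1, 0, 1}. ennreal (h / 36) \<le> slant_nn_int t h (\<lambda>p. ennreal (strain_sq p)) y) \<or>
      (\<exists>t\<in>{-1, 1}. ennreal (h / 2) \<le> slant_nn_int t h (\<lambda>p. ennreal ((w1 p + t * w2 p)\<^sup>2)) y)"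
    and slope: "h < y \<and> y < l2 - h \<longrightarrow> slant_nn_int (-1) h (\<lambda>p. ennreal ((w1 p - w2 p)\<^sup>2)) y
      \<le> 4 * ((slant_nn_int (-1) h (indicator {p. 0 < w p}) y)\<^sup>2 * slant_nn_int (-1) h (\<lambda>p. ennreal (hessian_sq p)) y)"
      "h < y \<and> y < l2 - h \<longrightarrow> slant_nn_int 1 h (\<lambda>p. ennreal ((w1 p + w2 p)\<^sup>2)) y
      \<le> 4 * ((slant_nn_int 1 h (indicator {p. 0 < w p}) y)\<^sup>2 * slant_nn_int 1 h (\<lambda>p. ennreal (hessian_sq p)) y)"
  define X where "X t = slant_nn_int t h (\<lambda>p. ennreal (strain_sq p)) y" for t
  define B where "B t = slant_nn_int t h (\<lambda>p. ennreal (hessian_sq p)) y" for t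
  define A where "A t = slant_nn_int t h (indicator {p. 0 < w p}) y" for t
  have D: "slant_nn_int t h D y = X t + ennreal K * B t + ennreal \<gamma> * A t" for t
    unfolding X_def A_def B_def D_def slant_nn_int_def
    by (simp add: distrib_right mult.assoc nn_integral_add nn_integral_cmult)
  have Ah: "A t \<le> ennreal h" for t
  proof -
    have "A t \<le> (\<integral>\<^sup>+ s. indicator {0<..<h} s \<partial>lborel)"
      unfolding A_def slant_nn_int_def by (intro nn_integral_mono) (auto simp: indicator_def)
    then show ?thesis using h by simp
  qed
  have "\<exists>t\<in>{-1, 0, 1}. ennreal m \<le> slant_nn_int t h D y"
    using dich[rule_format, OF y]
  proof (elim disjE bexE)
    fix t :: real assume t: "t \<in> {-1, 0, 1}" and "ennreal (h / 36) \<le> slant_nn_int t h (\<lambda>p. ennreal (strain_sq p)) y"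
    then have "ennreal (h / 36) \<le> X t" unfolding X_def by simp
    also have "X t \<le> slant_nn_int t h D y" unfolding D by (simp add: add.assoc)
    finally have "ennreal m \<le> slant_nn_int t h D y" using m by (meson ennreal_leI order_trans)
    then show ?thesis using t by blast
  next
    fix t :: real assume t: "t \<in> {-1, 1}" and l: "ennreal (h / 2) \<le> slant_nn_int t h (\<lambda>p. ennreal ((w1 p + t * w2 p)\<^sup>2)) y"
    \<comment> \<open>The factor 4 is the loss in passing from the second derivative along the line to the Hessian.\<close>
    have "4 * ennreal (h / 8) = ennreal (h / 2)"
      using ennreal_mult'[of 4 "h / 8"] h by simp
    also have "ennreal (h / 2) \<le> 4 * ((A t)\<^sup>2 * B t)"
      using l t slope y unfolding A_def B_def by force
    finally have "ennreal (h / 8) \<le> (A t)\<^sup>2 * B t"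
      by (subst (asm) ennreal_mult_le_mult_iff) auto
    then have "ennreal m \<le> ennreal \<gamma> * A t + ennreal K * B t" by (rule opt[OF Ah])
    also have "\<dots> \<le> slant_nn_int t h D y" unfolding D by (simp add: add_ac)
    finally show ?thesis using t by blast
  qed
  then show "ennreal m \<le> slant_nn_int (-1) h D y + slant_nn_int 0 h D y + slant_nn_int 1 h D y"
  proof -
    let ?S = "slant_nn_int (-1) h D y + slant_nn_int 0 h D y + slant_nn_int 1 h D y"
    have "slant_nn_int t h D y \<le> ?S" if "t \<in> {-1, 0, 1}" for t
      using that by (elim insertE emptyE) (simp_all add: add.assoc add_increasing)
    then show ?thesis using \<open>\<exists>t\<in>{-1, 0, 1}. ennreal m \<le> slant_nn_int t h D y\<close> order_trans by blast
  qed
qed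

lemma film_energy_ge:
  fixes K \<gamma> m :: real
  assumes h: "0 < h" "h \<le> l1" "2 * h \<le> l2" and m: "m \<le> h / 36"
    and opt: "\<And>a B. a \<le> ennreal h \<Longrightarrow> ennreal (h / 8) \<le> a\<^sup>2 * B \<Longrightarrow> ennreal m \<le> ennreal \<gamma> * a + ennreal K * B"
  shows "ennreal (m * (l2 - 2 * h)) \<le> 3 * film_energy K \<gamma>"
proof -
  let ?Q = "{0<..<l1} \<times> {0<..<l2}"
  have [measurable]: "?Q \<in> sets borel" by (intro borel_open open_Times) auto
  define D where "D p = ennreal (strain_sq p) + ennreal K * ennreal (hessian_sq p) + ennreal \<gamma> * indicator {p. 0 < w p} p" for p
  have [measurable]: "D \<in> borel_measurable borel" unfolding D_def by measurable
  have [measurable]: "(\<lambda>y. slant_nn_int t h D y) \<in> borel_measurable borel" for t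
    unfolding slant_nn_int_def by measurable
  have "ennreal (m * (l2 - 2 * h)) = ennreal m * emeasure lborel {h<..<l2 - h}"
  proof -
    have "emeasure lborel {h<..<l2 - h} = ennreal (l2 - 2 * h)" using h by simp
    then show ?thesis using h by (simp add: ennreal_mult'')
  qed
  also have "\<dots> = (\<integral>\<^sup>+ y. ennreal m * indicator {h<..<l2 - h} y \<partial>lborel)"
    by (rule nn_integral_cmult_indicator[symmetric]) simp
  also have "\<dots> \<le> (\<integral>\<^sup>+ y. slant_nn_int (-1) h D y * indicator {h<..<l2 - h} y
      + slant_nn_int 0 h D y * indicator {h<..<l2 - h} y + slant_nn_int 1 h D y * indicator {h<..<l2 - h} y \<partial>lborel)"
  proof (rule nn_integral_mono_AE)
    have "AE y in lborel. y \<in> {h<..<l2 - h} \<longrightarrow>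
      ennreal m \<le> slant_nn_int (-1) h D y + slant_nn_int 0 h D y + slant_nn_int 1 h D y"
      unfolding D_def[abs_def] by (rule AE_line_energy_ge[OF h(1,2) m], rule opt)
    then show "AE y in lborel. ennreal m * indicator {h<..<l2 - h} y \<le> slant_nn_int (-1) h D y * indicator {h<..<l2 - h} y
      + slant_nn_int 0 h D y * indicator {h<..<l2 - h} y + slant_nn_int 1 h D y * indicator {h<..<l2 - h} y"
      by eventually_elim (auto simp: indicator_def)
  qed
  also have "\<dots> = (\<integral>\<^sup>+ y\<in>{h<..<l2 - h}. slant_nn_int (-1) h D y \<partial>lborel)
      + (\<integral>\<^sup>+ y\<in>{h<..<l2 - h}. slant_nn_int 0 h D y \<partial>lborel) + (\<integral>\<^sup>+ y\<in>{h<..<l2 - h}. slant_nn_int 1 h D y \<partial>lborel)"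
    by (simp add: nn_integral_add)
  also have "\<dots> \<le> (\<integral>\<^sup>+ p\<in>?Q. D p \<partial>lborel) + (\<integral>\<^sup>+ p\<in>?Q. D p \<partial>lborel) + (\<integral>\<^sup>+ p\<in>?Q. D p \<partial>lborel)"
    unfolding slant_nn_int_def by (intro add_mono nn_integral_slant_le h) auto
  also have "(\<integral>\<^sup>+ p\<in>?Q. D p \<partial>lborel) = film_energy K \<gamma>"
    unfolding D_def film_energy_def by (simp add: distrib_right mult.assoc nn_integral_add nn_integral_cmult)
  also have "film_energy K \<gamma> + film_energy K \<gamma> + film_energy K \<gamma> = 3 * film_energy K \<gamma>"
  proof -
    have "(3::ennreal) = 1 + 1 + 1" by simp
    then show ?thesis by (simp only: distrib_right mult_1_left)
  qed
  finally show ?thesis .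
qed

text \<open>The first bound comes from a boundary layer of width \<open>h = \<sigma> l1 / 4\<close>, the second one from
  \<open>h = l1 / 4\<close>. In both cases the energy per line is \<open>l1 / 144\<close> times the claimed factor; with
  \<open>l2 - 2 h \<ge> l2 / 2\<close> and three lines per point the constant is \<open>1 / (144 * 2 * 3) = 1 / 864\<close>.\<close>
lemma film_energy_scaling:
  assumes \<sigma>: "0 < \<sigma>" "\<sigma> < 1" and \<gamma>: "0 \<le> \<gamma>" and l: "0 < l1" "l1 \<le> l2"
  shows "ennreal (1 / 864 * l1 * l2 * \<sigma>) \<le> film_energy ((\<sigma> * l1)\<^sup>2) \<gamma>"
    and "ennreal (1 / 864 * l1 * l2 * min 1 ((\<sigma> * \<gamma>) powr (2 / 3))) \<le> film_energy ((\<sigma> * l1)\<^sup>2) \<gamma>"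
proof -
  have K: "0 < (\<sigma> * l1)\<^sup>2" using \<sigma> l by simp
  have cancel: "ennreal (1 / 864 * l1 * l2 * r) \<le> film_energy ((\<sigma> * l1)\<^sup>2) \<gamma>"
    if E: "ennreal (l1 * r / 144 * (l2 - 2 * h)) \<le> 3 * film_energy ((\<sigma> * l1)\<^sup>2) \<gamma>"
      and r: "0 \<le> r" and h: "4 * h \<le> l1" for r h
  proof -
    have "l1 * r / 144 * (l2 / 2) \<le> l1 * r / 144 * (l2 - 2 * h)"
      using r h l by (intro mult_left_mono) auto
    then have "3 * (1 / 864 * l1 * l2 * r) \<le> l1 * r / 144 * (l2 - 2 * h)" by simp
    then have "ennreal (3 * (1 / 864 * l1 * l2 * r)) \<le> 3 * film_energy ((\<sigma> * l1)\<^sup>2) \<gamma>"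
      using E by (meson ennreal_leI order_trans)
    then have "3 * ennreal (1 / 864 * l1 * l2 * r) \<le> 3 * film_energy ((\<sigma> * l1)\<^sup>2) \<gamma>"
      by (subst (asm) ennreal_mult') auto
    then show ?thesis by (subst (asm) ennreal_mult_le_mult_iff) auto
  qed
  show "ennreal (1 / 864 * l1 * l2 * \<sigma>) \<le> film_energy ((\<sigma> * l1)\<^sup>2) \<gamma>"
  proof (rule cancel)
    let ?h = "\<sigma> * l1 / 4"
    have hl: "4 * ?h \<le> l1" using \<sigma> l by (simp add: mult_le_cancel_right1)
    then show "4 * ?h \<le> l1" .
    show "ennreal (l1 * \<sigma> / 144 * (l2 - 2 * ?h)) \<le> 3 * film_energy ((\<sigma> * l1)\<^sup>2) \<gamma>"
    proof (rule film_energy_ge)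
      show "0 < ?h" using \<sigma> l by simp
      show "?h \<le> l1" "2 * ?h \<le> l2" using hl l by linarith+
      show "l1 * \<sigma> / 144 \<le> ?h / 36" by (simp add: mult.commute)
      fix a B :: ennreal assume a: "a \<le> ennreal ?h" "ennreal (?h / 8) \<le> a\<^sup>2 * B"
      have "l1 * \<sigma> / 144 \<le> (\<sigma> * l1)\<^sup>2 / (8 * ?h)"
        using \<sigma> l by (simp add: power2_eq_square)
      then have "ennreal (l1 * \<sigma> / 144) \<le> ennreal ((\<sigma> * l1)\<^sup>2 / (8 * ?h))" by (rule ennreal_leI)
      also have "\<dots> \<le> ennreal ((\<sigma> * l1)\<^sup>2) * B"
        by (rule bending_alone_bound[OF \<open>0 < ?h\<close> K a])
      finally show "ennreal (l1 * \<sigma> / 144) \<le> ennreal \<gamma> * a + ennreal ((\<sigma> * l1)\<^sup>2) * B"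
        by (rule add_increasing[OF zero_le])
    qed
  qed (use \<sigma> in simp)
  define r where "r = min 1 ((\<sigma> * \<gamma>) powr (2 / 3))"
  have r: "0 \<le> r" "r \<le> 1" unfolding r_def by auto
  have r3: "r ^ 3 \<le> (\<sigma> * \<gamma>)\<^sup>2"
  proof (cases "\<gamma> = 0")
    case False
    then have pos: "0 < \<sigma> * \<gamma>" using \<sigma> \<gamma> by simp
    have "r ^ 3 \<le> ((\<sigma> * \<gamma>) powr (2 / 3)) ^ 3"
      using r unfolding r_def by (intro power_mono) auto
    also have "\<dots> = ((\<sigma> * \<gamma>) powr (2 / 3)) powr 3" using pos by (subst powr_numeral) auto
    also have "\<dots> = (\<sigma> * \<gamma>) powr 2" by (simp add: powr_powr)
    also have "\<dots> = (\<sigma> * \<gamma>)\<^sup>2" using pos by (subst powr_numeral) auto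
    finally show ?thesis .
  qed (simp add: r_def)
  show "ennreal (1 / 864 * l1 * l2 * min 1 ((\<sigma> * \<gamma>) powr (2 / 3))) \<le> film_energy ((\<sigma> * l1)\<^sup>2) \<gamma>"
    unfolding r_def[symmetric]
  proof (rule cancel)
    let ?h = "l1 / 4"
    show "ennreal (l1 * r / 144 * (l2 - 2 * ?h)) \<le> 3 * film_energy ((\<sigma> * l1)\<^sup>2) \<gamma>"
    proof (rule film_energy_ge)
      show h: "0 < ?h" and "?h \<le> l1" "2 * ?h \<le> l2" using l by auto
      show "l1 * r / 144 \<le> ?h / 36" using r l by (simp add: mult_left_le)
      fix a B :: ennreal assume a: "a \<le> ennreal ?h" "ennreal (?h / 8) \<le> a\<^sup>2 * B"
      have "(l1 * r / 144) ^ 3 = (l1 / 144) ^ 3 * r ^ 3" by (simp add: power_divide power_mult_distrib)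
      also have "\<dots> \<le> (l1 / 144) ^ 3 * (\<sigma> * \<gamma>)\<^sup>2" using l r3 by (intro mult_left_mono) auto
      also have "\<dots> \<le> l1 ^ 3 / 32 * (\<sigma> * \<gamma>)\<^sup>2"
        using l by (intro mult_right_mono) (auto simp: power_divide field_simps)
      also have "\<dots> = \<gamma>\<^sup>2 * (\<sigma> * l1)\<^sup>2 * ?h / 8"
        by (simp add: power2_eq_square power3_eq_cube)
      finally show "ennreal (l1 * r / 144) \<le> ennreal \<gamma> * a + ennreal ((\<sigma> * l1)\<^sup>2) * B"
        using l r by (intro bending_delamination_bound[OF h K \<gamma> a]) auto
    qed
  qed (use r in auto)
qed

end

section \<open>Borel representatives and traces\<close>

definition of_pair :: "real \<times> real \<Rightarrow> real^2" where
  "of_pair p = vector [fst p, snd p]"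

lemma of_pair_nth [simp]: "of_pair p $ 1 = fst p" "of_pair p $ 2 = snd p"
  by (simp_all add: of_pair_def vector_2)

lemma of_pair_eq: "of_pair p = fst p *\<^sub>R axis 1 1 + snd p *\<^sub>R axis 2 1"
  by (auto simp: vec_eq_iff forall_2 axis_def)

lemma of_pair_measurable [measurable]: "of_pair \<in> borel_measurable borel"
  by (rule borel_measurable_continuous_onI) (auto simp: of_pair_eq intro!: continuous_intros)

text \<open>Transfers integrals from \<open>real^2\<close>, on which the energy is defined, to pairs, on which the theorems
  of Fubini and Tonelli are available for the two coordinates.\<close>
lemma lborel_distr_of_pair: "distr lborel borel of_pair = lborel"
proof (rule lborel_eqI[symmetric])
  fix l u :: "real^2"
  assume le: "\<And>b. b \<in> Basis \<Longrightarrow> l \<bullet> b \<le> u \<bullet> b"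
  have le': "l $ i \<le> u $ i" for i
    using le[of "axis i 1"] by (simp add: axis_in_Basis_iff inner_axis)
  have "emeasure (distr lborel borel of_pair) (box l u) = emeasure lborel (of_pair -` box l u)"
    by (subst emeasure_distr) auto
  also have "of_pair -` box l u = {l $ 1<..<u $ 1} \<times> {l $ 2<..<u $ 2}"
    by (auto simp: mem_box_cart forall_2)
  also have "emeasure lborel \<dots> = emeasure (lborel \<Otimes>\<^sub>M lborel) ({l $ 1<..<u $ 1} \<times> {l $ 2<..<u $ 2})"
    by (simp only: lborel_prod)
  also have "\<dots> = emeasure lborel {l $ 1<..<u $ 1} * emeasure lborel {l $ 2<..<u $ 2}"
    by (rule lborel.emeasure_pair_measure_Times) auto
  also have "\<dots> = ennreal (\<Prod>i\<in>UNIV. (u - l) $ i)"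
    using le' by (simp add: prod_2 UNIV_2 ennreal_mult[symmetric])
  also have "(\<Prod>i\<in>UNIV. (u - l) $ i) = (\<Prod>b\<in>Basis. (u - l) \<bullet> b)"
    by (simp add: Basis_vec_def UNIV_2 inner_axis axis_eq_axis)
  finally show "emeasure (distr lborel borel of_pair) (box l u) = (\<Prod>b\<in>Basis. (u - l) \<bullet> b)" .
qed simp

lemma mem_rect [simp]: "of_pair p \<in> rect l1 l2 \<longleftrightarrow> p \<in> {0<..<l1} \<times> {0<..<l2}"
  by (cases p) (auto simp: rect_def mem_box_cart forall_2 vector_2)

lemma rect_sets [measurable]: "rect l1 l2 \<in> sets borel"
  by (simp add: rect_def)

lemma nn_integral_rect:
  fixes \<phi> :: "real^2 \<Rightarrow> ennreal" and \<psi> :: "real \<times> real \<Rightarrow> ennreal"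
  assumes [measurable]: "\<psi> \<in> borel_measurable borel"
    and eq: "AE p in lebesgue_on (rect l1 l2). \<phi> p = \<psi> (p $ 1, p $ 2)"
  shows "(\<integral>\<^sup>+ p. \<phi> p \<partial>lebesgue_on (rect l1 l2)) = (\<integral>\<^sup>+ p\<in>{0<..<l1} \<times> {0<..<l2}. \<psi> p \<partial>lborel)"
proof -
  have [measurable]: "(\<lambda>p::real^2. (p $ 1, p $ 2)) \<in> borel_measurable borel"
    by (intro borel_measurable_continuous_onI continuous_intros)
  have "(\<integral>\<^sup>+ p. \<phi> p \<partial>lebesgue_on (rect l1 l2)) = (\<integral>\<^sup>+ p. \<psi> (p $ 1, p $ 2) \<partial>lebesgue_on (rect l1 l2))"
    by (rule nn_integral_cong_AE[OF eq])
  also have "\<dots> = (\<integral>\<^sup>+ p. \<psi> (p $ 1, p $ 2) * indicator (rect l1 l2) p \<partial>lebesgue)"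
    by (rule nn_integral_restrict_space) (simp add: rect_def)
  also have "\<dots> = (\<integral>\<^sup>+ p. \<psi> (p $ 1, p $ 2) * indicator (rect l1 l2) p \<partial>lborel)"
    by (rule nn_integral_completion)
  also have "\<dots> = (\<integral>\<^sup>+ p. \<psi> (p $ 1, p $ 2) * indicator (rect l1 l2) p \<partial>distr lborel borel of_pair)"
    by (simp only: lborel_distr_of_pair)
  also have "\<dots> = (\<integral>\<^sup>+ p\<in>{0<..<l1} \<times> {0<..<l2}. \<psi> p \<partial>lborel)"
    by (subst nn_integral_distr) (auto intro!: nn_integral_cong simp: indicator_def)
  finally show ?thesis .
qed

lemma ex_Borel_representative:
  fixes g :: "real^2 \<Rightarrow> real"
  assumes g: "g \<in> borel_measurable (lebesgue_on (rect l1 l2))"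
  shows "\<exists>g' \<in> borel_measurable borel. AE p in lebesgue_on (rect l1 l2). g p = g' (p $ 1, p $ 2)"
proof -
  have R: "rect l1 l2 \<in> sets lebesgue" by (simp add: rect_def)
  \<comment> \<open>Extension by zero reduces the claim to functions on the whole plane.\<close>
  have "(\<lambda>x. if x \<in> rect l1 l2 then g x else 0) \<in> borel_measurable lebesgue"
    using g R borel_measurable_if by blast
  then obtain g' where g': "g' \<in> borel_measurable lborel"
    "AE x in lborel. (if x \<in> rect l1 l2 then g x else 0) = g' x"
    using completion_ex_borel_measurable_real by blast
  have [measurable]: "g' \<in> borel_measurable borel" using g' by simp
  have m: "(\<lambda>p. g' (of_pair p)) \<in> borel_measurable borel" by measurable
  have "AE x in lebesgue. (if x \<in> rect l1 l2 then g x else 0) = g' x"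
    using g'(2) by (rule AE_completion)
  then have "AE x in lebesgue. x \<in> rect l1 l2 \<longrightarrow> g x = g' x"
    by eventually_elim auto
  then have "AE p in lebesgue_on (rect l1 l2). g p = g' p"
    by (subst AE_restrict_space_iff) (use R in auto)
  moreover have "of_pair (p $ 1, p $ 2) = p" for p :: "real^2"
    by (simp add: vec_eq_iff forall_2)
  ultimately show ?thesis by (intro bexI[OF _ m]) simp
qed

lemma smooth_imp_C1:
  fixes F :: "real^2 \<Rightarrow> real"
  assumes F: "smooth F"
  shows "continuous_on UNIV (\<lambda>p. partial i F (of_pair p))"
    "((\<lambda>p. F (of_pair p)) has_derivative
      (\<lambda>v. fst v * partial 1 F (of_pair p) + snd v * partial 2 F (of_pair p))) (at p)"
proof -
  have "C_k (Suc 0) F" using F unfolding smooth_def by blast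
  then have d: "\<And>x. F differentiable (at x)" and c: "\<And>i. continuous_on UNIV (partial i F)"
    by auto
  have "continuous_on UNIV of_pair" unfolding of_pair_eq[abs_def] by (intro continuous_intros)
  then show "continuous_on UNIV (\<lambda>p. partial i F (of_pair p))"
    by (rule continuous_on_compose2[OF c]) auto
  define L where "L = frechet_derivative F (at (of_pair p))"
  have L: "(F has_derivative L) (at (of_pair p))"
    unfolding L_def using d frechet_derivative_works by blast
  then interpret L: linear L by (rule has_derivative_linear)
  have "(of_pair has_derivative of_pair) (at p)"
    unfolding of_pair_eq[abs_def] by (auto intro!: derivative_eq_intros)
  from has_derivative_compose[OF this L]
  show "((\<lambda>p. F (of_pair p)) has_derivative
      (\<lambda>v. fst v * partial 1 F (of_pair p) + snd v * partial 2 F (of_pair p))) (at p)"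
    by (rule has_derivative_eq_rhs)
       (auto simp: of_pair_eq L.add L.scaleR partial_def L_def[symmetric, unfolded of_pair_eq])
qed

lemma ennreal_power2_tendsto_zero_imp:
  fixes X :: "nat \<Rightarrow> ennreal"
  assumes "(\<lambda>n. (X n)\<^sup>2) \<longlonglongrightarrow> 0"
  shows "X \<longlonglongrightarrow> 0"
proof (rule order_tendstoI)
  fix a :: ennreal assume "0 < a"
  then have "0 < a\<^sup>2" by (simp add: power2_eq_square ennreal_zero_less_mult_iff)
  then have "\<forall>\<^sub>F n in sequentially. (X n)\<^sup>2 < a\<^sup>2" using order_tendstoD(2)[OF assms] by blast
  then show "\<forall>\<^sub>F n in sequentially. X n < a"
    by eventually_elim (meson not_le power_mono zero_le)
qed auto

text \<open>Turns \<open>L\<^sup>2\<close> convergence into \<open>L\<^sup>1\<close> convergence by way of the Cauchy-Schwarz inequality.\<close>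
lemma tendsto_zero_of_square_le:
  fixes X Y :: "nat \<Rightarrow> ennreal"
  assumes "\<And>n. (X n)\<^sup>2 \<le> ennreal c * Y n" "Y \<longlonglongrightarrow> 0"
  shows "X \<longlonglongrightarrow> 0"
proof (rule ennreal_power2_tendsto_zero_imp, rule tendsto_sandwich[OF _ _ tendsto_const])
  have "(\<lambda>n. ennreal c * Y n) \<longlonglongrightarrow> ennreal c * 0"
    by (intro ennreal_tendsto_cmult assms(2)) auto
  then show "(\<lambda>n. ennreal c * Y n) \<longlonglongrightarrow> 0" by simp
qed (use assms(1) in auto)

text \<open>Membership in \<open>H1\<close> guarantees that the choice operator in \<open>weak_partial\<close> picks a genuine weak
  derivative.\<close>
lemma L2_on_weak_partial:
  assumes "f \<in> H1 \<Omega>"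
  shows "L2_on \<Omega> (weak_partial \<Omega> i f)"
proof -
  obtain g where "has_weak_partial \<Omega> i f g" using assms unfolding H1_def by blast
  then have "has_weak_partial \<Omega> i f (weak_partial \<Omega> i f)"
    unfolding weak_partial_def by (rule someI[of "has_weak_partial \<Omega> i f"])
  then show ?thesis unfolding has_weak_partial_def by blast
qed

text \<open>Each of the three square integrals in \<open>H1_dist_sq\<close> is bounded by their sum, so all of them tend to
  zero, and on the bounded rectangle and edge \<open>L\<^sup>2\<close> convergence implies \<open>L\<^sup>1\<close> convergence.\<close>
lemma has_left_trace_zero_imp_zero_edge_H1:
  fixes f :: "real^2 \<Rightarrow> real"
  assumes tr: "has_left_trace l1 l2 f (\<lambda>_. 0)" and l: "0 \<le> l1" "0 \<le> l2"
    and m[measurable]: "f' \<in> borel_measurable borel" "d1 \<in> borel_measurable borel" "d2 \<in> borel_measurable borel"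
    and ae: "AE p in lebesgue_on (rect l1 l2). f p = f' (p $ 1, p $ 2)"
      "AE p in lebesgue_on (rect l1 l2). weak_partial (rect l1 l2) 1 f p = d1 (p $ 1, p $ 2)"
      "AE p in lebesgue_on (rect l1 l2). weak_partial (rect l1 l2) 2 f p = d2 (p $ 1, p $ 2)"
  shows "zero_edge_H1 l1 l2 f' d1 d2"
proof -
  let ?R = "rect l1 l2" and ?Q = "{0<..<l1} \<times> {0<..<l2}"
  obtain F where F: "\<And>n::nat. smooth (F n)"
    and lim: "(\<lambda>n. H1_dist_sq ?R (F n) f) \<longlonglongrightarrow> 0"
      "(\<lambda>n. \<integral>\<^sup>+y. ennreal ((F n (vector [0, y]) - 0)\<^sup>2) \<partial>lebesgue_on {0<..<l2}) \<longlonglongrightarrow> 0"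
    and H1: "f \<in> H1 ?R"
    using tr unfolding has_left_trace_def by blast
  have L2: "L2_on ?R (weak_partial ?R i f)" for i
    by (rule L2_on_weak_partial[OF H1])
  define G where "G n p = F n (of_pair p)" for n p
  define D where "D i n p = partial i (F n) (of_pair p)" for i n p
  have D: "continuous_on UNIV (D i n)" for i n
    unfolding D_def by (rule smooth_imp_C1(1)[OF F])
  have G: "(G n has_derivative (\<lambda>v. fst v * D 1 n p + snd v * D 2 n p)) (at p)" for n p
    unfolding G_def D_def by (rule smooth_imp_C1(2)[OF F])
  have [measurable]: "D i n \<in> borel_measurable borel" for i n
    by (rule borel_measurable_continuous_onI[OF D])
  have [measurable]: "G n \<in> borel_measurable borel" for n
    by (rule borel_measurable_continuous_onI, rule has_derivative_continuous_on, rule G)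
  have pair: "of_pair (p $ 1, p $ 2) = p" for p :: "real^2"
    by (simp add: vec_eq_iff forall_2)
  have fin: "(\<integral>\<^sup>+ p\<in>?Q. ennreal ((d p)\<^sup>2) \<partial>lborel) < \<infinity>"
    if "AE p in lebesgue_on ?R. weak_partial ?R i f p = d (p $ 1, p $ 2)" and [measurable]: "d \<in> borel_measurable borel" for i d
  proof -
    have "(\<integral>\<^sup>+ p. ennreal ((weak_partial ?R i f p)\<^sup>2) \<partial>lebesgue_on ?R) = (\<integral>\<^sup>+ p\<in>?Q. ennreal ((d p)\<^sup>2) \<partial>lborel)"
      by (rule nn_integral_rect, measurable) (use that(1) in \<open>eventually_elim, auto\<close>)
    moreover have "(\<integral>\<^sup>+ p. ennreal ((weak_partial ?R i f p)\<^sup>2) \<partial>lebesgue_on ?R) < \<infinity>"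
      using L2[of i] unfolding L2_on_def by (auto simp: integrable_iff_bounded)
    ultimately show ?thesis by simp
  qed
  have dist: "H1_dist_sq ?R (F n) f = (\<integral>\<^sup>+ p\<in>?Q. ennreal ((G n p - f' p)\<^sup>2) \<partial>lborel)
      + ((\<integral>\<^sup>+ p\<in>?Q. ennreal ((D 1 n p - d1 p)\<^sup>2) \<partial>lborel) + (\<integral>\<^sup>+ p\<in>?Q. ennreal ((D 2 n p - d2 p)\<^sup>2) \<partial>lborel))" for n
  proof -
    have "(\<integral>\<^sup>+ p. ennreal ((F n p - f p)\<^sup>2) \<partial>lebesgue_on ?R) = (\<integral>\<^sup>+ p\<in>?Q. ennreal ((G n p - f' p)\<^sup>2) \<partial>lborel)"
      by (rule nn_integral_rect, measurable) (use ae(1) in \<open>eventually_elim, auto simp: G_def pair\<close>)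
    moreover have "(\<integral>\<^sup>+ p. ennreal ((partial 1 (F n) p - weak_partial ?R 1 f p)\<^sup>2) \<partial>lebesgue_on ?R) = (\<integral>\<^sup>+ p\<in>?Q. ennreal ((D 1 n p - d1 p)\<^sup>2) \<partial>lborel)"
      by (rule nn_integral_rect, measurable) (use ae(2) in \<open>eventually_elim, auto simp: D_def pair\<close>)
    moreover have "(\<integral>\<^sup>+ p. ennreal ((partial 2 (F n) p - weak_partial ?R 2 f p)\<^sup>2) \<partial>lebesgue_on ?R) = (\<integral>\<^sup>+ p\<in>?Q. ennreal ((D 2 n p - d2 p)\<^sup>2) \<partial>lborel)"
      by (rule nn_integral_rect, measurable) (use ae(3) in \<open>eventually_elim, auto simp: D_def pair\<close>)
    ultimately show ?thesis unfolding H1_dist_sq_def by (simp add: sum_2)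
  qed
  have l0: "(\<lambda>n. \<integral>\<^sup>+ p\<in>?Q. ennreal ((G n p - f' p)\<^sup>2) \<partial>lborel) \<longlonglongrightarrow> 0"
    by (rule tendsto_sandwich[OF _ _ tendsto_const lim(1)]) (auto simp: dist intro!: always_eventually)
  have l1': "(\<lambda>n. \<integral>\<^sup>+ p\<in>?Q. ennreal ((D 1 n p - d1 p)\<^sup>2) \<partial>lborel) \<longlonglongrightarrow> 0"
    by (rule tendsto_sandwich[OF _ _ tendsto_const lim(1)])
       (auto simp: dist intro!: always_eventually add_increasing add_increasing2)
  have l2': "(\<lambda>n. \<integral>\<^sup>+ p\<in>?Q. ennreal ((D 2 n p - d2 p)\<^sup>2) \<partial>lborel) \<longlonglongrightarrow> 0"
    by (rule tendsto_sandwich[OF _ _ tendsto_const lim(1)])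
       (auto simp: dist intro!: always_eventually add_increasing add_increasing2)
  have edge: "(\<integral>\<^sup>+y. ennreal ((F n (vector [0, y]) - 0)\<^sup>2) \<partial>lebesgue_on {0<..<l2})
      = (\<integral>\<^sup>+ y\<in>{0<..<l2}. ennreal ((G n (0, y))\<^sup>2) \<partial>lborel)" for n
  proof -
    have "(\<integral>\<^sup>+y. ennreal ((F n (vector [0, y]) - 0)\<^sup>2) \<partial>lebesgue_on {0<..<l2})
      = (\<integral>\<^sup>+y. ennreal ((G n (0, y))\<^sup>2) * indicator {0<..<l2} y \<partial>lebesgue)"
      by (subst nn_integral_restrict_space) (auto simp: G_def of_pair_def)
    then show ?thesis by (simp only: nn_integral_completion)
  qed
  have rectangle: "(\<integral>\<^sup>+ p\<in>?Q. ennreal \<bar>g p\<bar> \<partial>lborel)\<^sup>2 \<le> ennreal (l1 * l2) * (\<integral>\<^sup>+ p\<in>?Q. ennreal ((g p)\<^sup>2) \<partial>lborel)"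
    if [measurable]: "g \<in> borel_measurable borel" for g
  proof -
    have [measurable]: "?Q \<in> sets borel" by (intro borel_open open_Times) auto
    have "emeasure lborel ?Q = emeasure (lborel \<Otimes>\<^sub>M lborel) ?Q" by (simp only: lborel_prod)
    also have "\<dots> = emeasure lborel {0<..<l1} * emeasure lborel {0<..<l2}"
      by (rule lborel.emeasure_pair_measure_Times) auto
    finally have "emeasure lborel ?Q = ennreal (l1 * l2)" using l by (simp add: ennreal_mult)
    then show ?thesis using set_nn_integral_abs_power2_le[of g lborel ?Q] by simp
  qed
  have edge_bound: "(\<integral>\<^sup>+ y\<in>{0<..<l2}. ennreal \<bar>g y\<bar> \<partial>lborel)\<^sup>2 \<le> ennreal l2 * (\<integral>\<^sup>+ y\<in>{0<..<l2}. ennreal ((g y)\<^sup>2) \<partial>lborel)"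
    if "g \<in> borel_measurable borel" for g
    using set_nn_integral_abs_power2_le[of g lborel "{0<..<l2}"] that l by simp
  have "\<exists>F D1 D2. (\<forall>n::nat. continuous_on UNIV (D1 n) \<and> continuous_on UNIV (D2 n) \<and>
          (\<forall>p. (F n has_derivative (\<lambda>v. fst v * D1 n p + snd v * D2 n p)) (at p))) \<and>
        (\<lambda>n. \<integral>\<^sup>+ p\<in>?Q. ennreal \<bar>F n p - f' p\<bar> \<partial>lborel) \<longlonglongrightarrow> 0 \<and>
        (\<lambda>n. \<integral>\<^sup>+ p\<in>?Q. ennreal \<bar>D1 n p - d1 p\<bar> \<partial>lborel) \<longlonglongrightarrow> 0 \<and>
        (\<lambda>n. \<integral>\<^sup>+ p\<in>?Q. ennreal \<bar>D2 n p - d2 p\<bar> \<partial>lborel) \<longlonglongrightarrow> 0 \<and>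
        (\<lambda>n. \<integral>\<^sup>+ y\<in>{0<..<l2}. ennreal \<bar>F n (0, y)\<bar> \<partial>lborel) \<longlonglongrightarrow> 0"
  proof (intro exI conjI allI)
    show "continuous_on UNIV (D 1 n)" "continuous_on UNIV (D 2 n)" for n by (rule D)+
    show "(G n has_derivative (\<lambda>v. fst v * D 1 n p + snd v * D 2 n p)) (at p)" for n p by (rule G)
    show "(\<lambda>n. \<integral>\<^sup>+ p\<in>?Q. ennreal \<bar>G n p - f' p\<bar> \<partial>lborel) \<longlonglongrightarrow> 0"
      by (rule tendsto_zero_of_square_le[OF rectangle l0]) measurable
    show "(\<lambda>n. \<integral>\<^sup>+ p\<in>?Q. ennreal \<bar>D 1 n p - d1 p\<bar> \<partial>lborel) \<longlonglongrightarrow> 0"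
      by (rule tendsto_zero_of_square_le[OF rectangle l1']) measurable
    show "(\<lambda>n. \<integral>\<^sup>+ p\<in>?Q. ennreal \<bar>D 2 n p - d2 p\<bar> \<partial>lborel) \<longlonglongrightarrow> 0"
      by (rule tendsto_zero_of_square_le[OF rectangle l2']) measurable
    show "(\<lambda>n. \<integral>\<^sup>+ y\<in>{0<..<l2}. ennreal \<bar>G n (0, y)\<bar> \<partial>lborel) \<longlonglongrightarrow> 0"
      by (rule tendsto_zero_of_square_le[OF edge_bound lim(2)[unfolded edge]]) measurable
  qed
  then show ?thesis
    unfolding zero_edge_H1_def using fin[OF ae(2) m(2)] fin[OF ae(3) m(3)] m by blast
qed

text \<open>The weak derivatives are only Lebesgue measurable, and the traces are stated for these very
  functions. So one Borel representative is fixed for each of them and used in all its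
  roles: the representative of the gradient of \<open>w\<close> is at the same time the derivative of \<open>w\<close> and a function
  with zero trace of its own.\<close>
lemma admissible_imp_clamped_film:
  assumes V: "(u, w) \<in> V l1 l2" and l: "0 \<le> l1" "0 \<le> l2"
  shows "\<exists>u1 u2 a11 a12 a21 a22 w' w1 w2 w11 w12 w21 w22.
    clamped_film l1 l2 u1 u2 a11 a12 a21 a22 w' w1 w2 w11 w12 w21 w22 \<and>
    (\<forall>\<sigma> \<gamma>. energy \<sigma> \<gamma> l1 l2 u w
      = clamped_film.film_energy l1 l2 a11 a12 a21 a22 w' w1 w2 w11 w12 w21 w22 ((\<sigma> * l1)\<^sup>2) \<gamma>)"
proof -
  let ?R = "rect l1 l2" and ?d = "weak_partial (rect l1 l2)" and ?u = "\<lambda>i p. u p $ i"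
  have uH: "?u i \<in> H1 ?R" and wH: "w \<in> H1 ?R" "?d i w \<in> H1 ?R"
    and tw: "has_left_trace l1 l2 w (\<lambda>_. 0)"
    and tu: "has_left_trace l1 l2 (?u i) (\<lambda>_. 0)"
    and tdw: "has_left_trace l1 l2 (?d i w) (\<lambda>_. 0)"
    and pos: "AE p in lebesgue_on ?R. 0 \<le> w p" for i
    using V unfolding V_def H2_def by auto
  define rep where "rep f g \<longleftrightarrow> g \<in> borel_measurable borel \<and> (AE p in lebesgue_on ?R. f p = g (p $ 1, p $ 2))"
    for f :: "real^2 \<Rightarrow> real" and g :: "real \<times> real \<Rightarrow> real"
  have ex_rep: "\<exists>g. rep f g" if "L2_on ?R f" for f
    using ex_Borel_representative[of f l1 l2] that unfolding L2_on_def rep_def by blast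
  have H1L2: "L2_on ?R f" if "f \<in> H1 ?R" for f using that unfolding H1_def by blast
  have "\<exists>U. \<forall>i. rep (?u i) (U i)"
    by (intro choice allI ex_rep[OF H1L2[OF uH]])
  then obtain U where "\<And>i. rep (?u i) (U i)" by blast
  then have U: "U i \<in> borel_measurable borel" "AE p in lebesgue_on ?R. ?u i p = U i (p $ 1, p $ 2)" for i
    unfolding rep_def by blast+
  have "\<exists>A. \<forall>i j. rep (?d j (?u i)) (A i j)"
    by (rule choice, rule allI, rule choice, rule allI, rule ex_rep[OF L2_on_weak_partial[OF uH]])
  then obtain A where "\<And>i j. rep (?d j (?u i)) (A i j)" by blast
  then have A: "A i j \<in> borel_measurable borel" "AE p in lebesgue_on ?R. ?d j (?u i) p = A i j (p $ 1, p $ 2)" for i j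
    unfolding rep_def by blast+
  obtain W where W: "W \<in> borel_measurable borel" "AE p in lebesgue_on ?R. w p = W (p $ 1, p $ 2)"
    using ex_rep[OF H1L2[OF wH(1)]] unfolding rep_def by blast
  have "\<exists>G. \<forall>i. rep (?d i w) (G i)"
    by (intro choice allI ex_rep[OF L2_on_weak_partial[OF wH(1)]])
  then obtain G where "\<And>i. rep (?d i w) (G i)" by blast
  then have G: "G i \<in> borel_measurable borel" "AE p in lebesgue_on ?R. ?d i w p = G i (p $ 1, p $ 2)" for i
    unfolding rep_def by blast+
  have "\<exists>H. \<forall>i j. rep (?d j (?d i w)) (H i j)"
    by (rule choice, rule allI, rule choice, rule allI, rule ex_rep[OF L2_on_weak_partial[OF wH(2)]])
  then obtain H where "\<And>i j. rep (?d j (?d i w)) (H i j)" by blast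
  then have H: "H i j \<in> borel_measurable borel" "AE p in lebesgue_on ?R. ?d j (?d i w) p = H i j (p $ 1, p $ 2)" for i j
    unfolding rep_def by blast+
  interpret clamped_film l1 l2 "U 1" "U 2" "A 1 1" "A 1 2" "A 2 1" "A 2 2" W "G 1" "G 2"
    "H 1 1" "H 1 2" "H 2 1" "H 2 2"
  proof
    show "zero_edge_H1 l1 l2 (U 1) (A 1 1) (A 1 2)" "zero_edge_H1 l1 l2 (U 2) (A 2 1) (A 2 2)"
      by (rule has_left_trace_zero_imp_zero_edge_H1[OF tu l U(1) A(1) A(1) U(2) A(2) A(2)])+
    show "zero_edge_H1 l1 l2 W (G 1) (G 2)"
      by (rule has_left_trace_zero_imp_zero_edge_H1[OF tw l W(1) G(1) G(1) W(2) G(2) G(2)])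
    show "zero_edge_H1 l1 l2 (G 1) (H 1 1) (H 1 2)" "zero_edge_H1 l1 l2 (G 2) (H 2 1) (H 2 2)"
      by (rule has_left_trace_zero_imp_zero_edge_H1[OF tdw l G(1) H(1) H(1) G(2) H(2) H(2)])+
    have Wm[measurable]: "W \<in> borel_measurable borel" by (rule W)
    have Qm[measurable]: "{0<..<l1} \<times> {0<..<l2} \<in> sets borel" by (intro borel_open open_Times) auto
    have "(\<integral>\<^sup>+ p\<in>{0<..<l1} \<times> {0<..<l2}. indicator {p. W p < 0} p \<partial>lborel)
        = (\<integral>\<^sup>+ p. indicator {p. w p < 0} p \<partial>lebesgue_on ?R)"
      by (rule nn_integral_rect[symmetric], measurable) (use W(2) in \<open>eventually_elim, auto simp: indicator_def\<close>)
    also have "\<dots> = (\<integral>\<^sup>+ p. 0 \<partial>lebesgue_on ?R)"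
      by (rule nn_integral_cong_AE) (use pos in \<open>eventually_elim, auto simp: indicator_def\<close>)
    finally have "(\<integral>\<^sup>+ p\<in>{0<..<l1} \<times> {0<..<l2}. indicator {p. W p < 0} p \<partial>lborel) = 0" by simp
    then have "AE p in lborel. indicator {p. W p < 0} p * indicator ({0<..<l1} \<times> {0<..<l2}) p = (0::ennreal)"
      by (subst (asm) nn_integral_0_iff_AE) auto
    then show "AE p in lborel. p \<in> {0<..<l1} \<times> {0<..<l2} \<longrightarrow> 0 \<le> W p"
      by eventually_elim (auto simp: indicator_def not_less split: if_splits)
  qed
  have "energy \<sigma> \<gamma> l1 l2 u w = film_energy ((\<sigma> * l1)\<^sup>2) \<gamma>" for \<sigma> \<gamma>
  proof -
    have "(\<integral>\<^sup>+p. ennreal ((norm (weak_jacobian ?R u p + transpose (weak_jacobian ?R u p)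
                 + tensor (weak_grad ?R w p) (weak_grad ?R w p) - mat 1))\<^sup>2) \<partial>lebesgue_on ?R)
        = (\<integral>\<^sup>+ p\<in>{0<..<l1} \<times> {0<..<l2}. ennreal (strain_sq p) \<partial>lborel)"
    proof (rule nn_integral_rect)
      show "AE p in lebesgue_on ?R. ennreal ((norm (weak_jacobian ?R u p + transpose (weak_jacobian ?R u p)
                 + tensor (weak_grad ?R w p) (weak_grad ?R w p) - mat 1))\<^sup>2) = ennreal (strain_sq (p $ 1, p $ 2))"
        using A(2)[of 1 1] A(2)[of 1 2] A(2)[of 2 1] A(2)[of 2 2] G(2)[of 1] G(2)[of 2]
        by eventually_elim
           (rule arg_cong[where f=ennreal], simp only: norm_matrix_sq sum_2,
            simp add: weak_jacobian_def transpose_def tensor_def weak_grad_def mat_def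
              strain_sq_def e11_def e12_def e22_def,
            simp add: power2_eq_square algebra_simps)
    qed measurable
    moreover have "(\<integral>\<^sup>+p. ennreal ((norm (weak_hessian ?R w p))\<^sup>2) \<partial>lebesgue_on ?R)
        = (\<integral>\<^sup>+ p\<in>{0<..<l1} \<times> {0<..<l2}. ennreal (hessian_sq p) \<partial>lborel)"
    proof (rule nn_integral_rect)
      show "AE p in lebesgue_on ?R. ennreal ((norm (weak_hessian ?R w p))\<^sup>2) = ennreal (hessian_sq (p $ 1, p $ 2))"
        using H(2)[of 1 1] H(2)[of 1 2] H(2)[of 2 1] H(2)[of 2 2]
        by eventually_elim
           (simp add: norm_matrix_sq sum_2 weak_hessian_def weak_jacobian_def weak_grad_def hessian_sq_def)
    qed measurable
    moreover have "emeasure lebesgue {p \<in> ?R. w p > 0}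
        = (\<integral>\<^sup>+ p\<in>{0<..<l1} \<times> {0<..<l2}. indicator {p. 0 < W p} p \<partial>lborel)"
    proof -
      have R: "?R \<in> sets lebesgue" by (simp add: rect_def)
      have "w \<in> borel_measurable (lebesgue_on ?R)" using H1L2[OF wH(1)] unfolding L2_on_def by blast
      then have "{p \<in> space (lebesgue_on ?R). 0 < w p} \<in> sets (lebesgue_on ?R)" by measurable
      then have S: "{p \<in> ?R. w p > 0} \<in> sets (lebesgue_on ?R)" by (simp add: space_restrict_space)
      have "emeasure lebesgue {p \<in> ?R. w p > 0} = emeasure (lebesgue_on ?R) {p \<in> ?R. w p > 0}"
        by (rule emeasure_restrict_space[symmetric]) (use R in auto)
      also have "\<dots> = (\<integral>\<^sup>+ p. indicator {p \<in> ?R. w p > 0} p \<partial>lebesgue_on ?R)"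
        using S by simp
      also have "\<dots> = (\<integral>\<^sup>+ p. indicator {p. w p > 0} p \<partial>lebesgue_on ?R)"
        by (rule nn_integral_cong) (auto simp: space_restrict_space indicator_def)
      also have "\<dots> = (\<integral>\<^sup>+ p\<in>{0<..<l1} \<times> {0<..<l2}. indicator {p. 0 < W p} p \<partial>lborel)"
        by (rule nn_integral_rect, measurable) (use W(2) in \<open>eventually_elim, auto simp: indicator_def\<close>)
      finally show ?thesis .
    qed
    ultimately show ?thesis
      unfolding energy_def film_energy_def Let_def by simp
  qed
  then show ?thesis using clamped_film_axioms by blast
qed

section \<open>The scaling bound\<close>

theorem theorem2p2:
  shows "\<exists>c::real. c > 0 \<and>
    (\<forall>\<gamma> \<sigma> l1 l2 :: real. \<gamma> \<ge> 0 \<longrightarrow> 0 < \<sigma> \<longrightarrow> \<sigma> < 1 \<longrightarrow> 0 < l1 \<longrightarrow> l1 \<le> l2 \<longrightarrow>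
      (\<forall>(u, w) \<in> V l1 l2.
        energy \<sigma> \<gamma> l1 l2 u w \<ge>
          ennreal (c * l1 * l2 *
            (if \<gamma> \<ge> 1 / \<sigma> then 1
             else if \<sigma> powr (1/2) \<le> \<gamma> then (\<sigma> * \<gamma>) powr (2/3)
             else \<sigma>))))"
proof (intro exI[of _ "1 / 864"] conjI allI impI)
  fix \<gamma> \<sigma> l1 l2 :: real
  assume \<gamma>: "0 \<le> \<gamma>" and \<sigma>: "0 < \<sigma>" "\<sigma> < 1" and l: "0 < l1" "l1 \<le> l2"
  show "\<forall>(u, w) \<in> V l1 l2. energy \<sigma> \<gamma> l1 l2 u w \<ge> ennreal (1 / 864 * l1 * l2 *
            (if \<gamma> \<ge> 1 / \<sigma> then 1
             else if \<sigma> powr (1/2) \<le> \<gamma> then (\<sigma> * \<gamma>) powr (2/3)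
             else \<sigma>))"
  proof clarify
    fix u w assume "(u, w) \<in> V l1 l2"
    then obtain u1 u2 a11 a12 a21 a22 w' w1 w2 w11 w12 w21 w22
      where film: "clamped_film l1 l2 u1 u2 a11 a12 a21 a22 w' w1 w2 w11 w12 w21 w22"
        and E: "\<And>\<sigma> \<gamma>. energy \<sigma> \<gamma> l1 l2 u w
          = clamped_film.film_energy l1 l2 a11 a12 a21 a22 w' w1 w2 w11 w12 w21 w22 ((\<sigma> * l1)\<^sup>2) \<gamma>"
      using admissible_imp_clamped_film[of u w l1 l2] l by auto
    note bounds = clamped_film.film_energy_scaling[OF film \<sigma> \<gamma> l, folded E]
    have big: "min 1 ((\<sigma> * \<gamma>) powr (2 / 3)) = 1" if "1 / \<sigma> \<le> \<gamma>"
      using that \<sigma> by (simp add: min_def ge_one_powr_ge_zero field_simps)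
    have small: "min 1 ((\<sigma> * \<gamma>) powr (2 / 3)) = (\<sigma> * \<gamma>) powr (2 / 3)" if "\<not> 1 / \<sigma> \<le> \<gamma>"
    proof -
      have "\<sigma> * \<gamma> \<le> 1" using that \<sigma> by (simp add: field_simps)
      then have "(\<sigma> * \<gamma>) powr (2 / 3) \<le> 1" using \<sigma> \<gamma> by (intro powr_le1) auto
      then show ?thesis by simp
    qed
    show "ennreal (1 / 864 * l1 * l2 *
            (if \<gamma> \<ge> 1 / \<sigma> then 1
             else if \<sigma> powr (1/2) \<le> \<gamma> then (\<sigma> * \<gamma>) powr (2/3)
             else \<sigma>)) \<le> energy \<sigma> \<gamma> l1 l2 u w"
      using bounds big small by auto
  qed
qed simp

end
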